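(* Let $\mathbb{A}$ be a ring that is finitely generated as a module over its center $R:=\mathcal{Z}(\mathbb{A})$. Then $\mathbb{A}$ is weakly left Jacobson if and only if $\mathbb{A}$ is Jacobson.
   Context: All rings are associative and unital. A left ideal $I$ of a ring $\mathbb{A}$ is prime if for all $a,b\in\mathbb{A}$ with $a\mathbb{A}b\subseteq I$ we have $a\in I$ or $b\in I$. A ring is weakly left Jacobson if every prime left ideal is an intersection of maximal left ideals (the empty intersection being the whole ring). A ring is Jacobson if every (two-sided) prime ideal is an intersection of left-primitive ideals, where a left-primitive ideal is the annihilator of a simple left module. *)

theory Defs
  imports "HOL-Algebra.Module" "HOL-Algebra.Ideal" "HOL-Algebra.Subrings"
begin

section \<open>Left ideals and primes\<close>

locale left_ideal = additive_subgroup I R + ring R for I and R (structure) +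
  assumes I_l_closed: "\<lbrakk>a \<in> I; x \<in> carrier R\<rbrakk> \<Longrightarrow> x \<otimes> a \<in> I"

locale maximal_left_ideal = left_ideal +
  assumes I_notcarr: "carrier R \<noteq> I"
    and I_maximal: "\<lbrakk>left_ideal J R; I \<subseteq> J; J \<subseteq> carrier R\<rbrakk> \<Longrightarrow> J = I \<or> J = carrier R"

text \<open>Primes are not required to be proper. The whole ring is the intersection of the empty family
  (see \<open>intersection_of\<close> below), so this has no effect on the two Jacobson properties.\<close>

definition prime_condition :: "'a set \<Rightarrow> ('a, 'm) ring_scheme \<Rightarrow> bool" where
  "prime_condition I R \<longleftrightarrow>
    (\<forall>a\<in>carrier R. \<forall>b\<in>carrier R.
      (\<forall>x\<in>carrier R. a \<otimes>\<^bsub>R\<^esub> x \<otimes>\<^bsub>R\<^esub> b \<in> I) \<longrightarrow> a \<in> I \<or> b \<in> I)"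

definition prime_left_ideal :: "'a set \<Rightarrow> ('a, 'm) ring_scheme \<Rightarrow> bool" where
  "prime_left_ideal I R \<longleftrightarrow> left_ideal I R \<and> prime_condition I R"

text \<open>The library's \<open>primeideal\<close> extends \<open>cring\<close>, so it does not apply to noncommutative rings.\<close>

definition prime_two_sided_ideal :: "'a set \<Rightarrow> ('a, 'm) ring_scheme \<Rightarrow> bool" where
  "prime_two_sided_ideal I R \<longleftrightarrow> ideal I R \<and> prime_condition I R"


section \<open>Left modules and primitive ideals\<close>

text \<open>The library's \<open>module\<close> without commutativity of the scalars. Its \<open>submodule\<close> does not assume
  commutativity and is used unchanged.\<close>

locale left_module = R?: ring R + M?: abelian_group M
  for R :: "('a, 'm) ring_scheme" and M :: "('a, 'b, 'n) module_scheme" +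
  assumes smult_closed [simp, intro]:
      "\<lbrakk>a \<in> carrier R; x \<in> carrier M\<rbrakk> \<Longrightarrow> a \<odot>\<^bsub>M\<^esub> x \<in> carrier M"
    and smult_l_distr:
      "\<lbrakk>a \<in> carrier R; b \<in> carrier R; x \<in> carrier M\<rbrakk> \<Longrightarrow>
      (a \<oplus>\<^bsub>R\<^esub> b) \<odot>\<^bsub>M\<^esub> x = a \<odot>\<^bsub>M\<^esub> x \<oplus>\<^bsub>M\<^esub> b \<odot>\<^bsub>M\<^esub> x"
    and smult_r_distr:
      "\<lbrakk>a \<in> carrier R; x \<in> carrier M; y \<in> carrier M\<rbrakk> \<Longrightarrow>
      a \<odot>\<^bsub>M\<^esub> (x \<oplus>\<^bsub>M\<^esub> y) = a \<odot>\<^bsub>M\<^esub> x \<oplus>\<^bsub>M\<^esub> a \<odot>\<^bsub>M\<^esub> y"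
    and smult_assoc1:
      "\<lbrakk>a \<in> carrier R; b \<in> carrier R; x \<in> carrier M\<rbrakk> \<Longrightarrow>
      (a \<otimes>\<^bsub>R\<^esub> b) \<odot>\<^bsub>M\<^esub> x = a \<odot>\<^bsub>M\<^esub> (b \<odot>\<^bsub>M\<^esub> x)"
    and smult_one [simp]:
      "x \<in> carrier M \<Longrightarrow> \<one>\<^bsub>R\<^esub> \<odot>\<^bsub>M\<^esub> x = x"

definition simple_left_module ::
    "('a, 'm) ring_scheme \<Rightarrow> ('a, 'b, 'n) module_scheme \<Rightarrow> bool" where
  "simple_left_module R M \<longleftrightarrow>
    left_module R M \<and> carrier M \<noteq> {\<zero>\<^bsub>M\<^esub>} \<and>
    (\<forall>H. submodule H R M \<longrightarrow> H = {\<zero>\<^bsub>M\<^esub>} \<or> H = carrier M)"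

definition annihilator ::
    "('a, 'm) ring_scheme \<Rightarrow> ('a, 'b, 'n) module_scheme \<Rightarrow> 'a set" where
  "annihilator R M = {a \<in> carrier R. \<forall>x\<in>carrier M. a \<odot>\<^bsub>M\<^esub> x = \<zero>\<^bsub>M\<^esub>}"

text \<open>A simple left module is a quotient of the ring, so one with elements of type \<^typ>\<open>'a set\<close>
  always suffices; \<open>left_primitive_annihilator\<close> below shows that fixing this type loses no
  annihilators.\<close>

definition left_primitive_ideal :: "'a set \<Rightarrow> ('a, 'm) ring_scheme \<Rightarrow> bool" where
  "left_primitive_ideal I R \<longleftrightarrow>
    (\<exists>M :: ('a, 'a set) module. simple_left_module R M \<and> I = annihilator R M)"


section \<open>Jacobson properties\<close>

text \<open>Intersecting with the carrier makes the empty intersection the whole ring.\<close>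

definition intersection_of :: "('a, 'm) ring_scheme \<Rightarrow> ('a set \<Rightarrow> bool) \<Rightarrow> 'a set \<Rightarrow> bool" where
  "intersection_of R P I \<longleftrightarrow> (\<exists>F. (\<forall>J\<in>F. P J) \<and> I = carrier R \<inter> \<Inter>F)"

definition weakly_left_jacobson :: "('a, 'm) ring_scheme \<Rightarrow> bool" where
  "weakly_left_jacobson R \<longleftrightarrow>
    (\<forall>I. prime_left_ideal I R \<longrightarrow> intersection_of R (\<lambda>J. maximal_left_ideal J R) I)"

definition jacobson :: "('a, 'm) ring_scheme \<Rightarrow> bool" where
  "jacobson R \<longleftrightarrow>
    (\<forall>I. prime_two_sided_ideal I R \<longrightarrow> intersection_of R (\<lambda>J. left_primitive_ideal J R) I)"


section \<open>Finite generation over the center\<close>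

definition ring_center :: "('a, 'm) ring_scheme \<Rightarrow> ('a, 'm) ring_scheme" where
  "ring_center A =
    A\<lparr>carrier := {z \<in> carrier A. \<forall>x\<in>carrier A. z \<otimes>\<^bsub>A\<^esub> x = x \<otimes>\<^bsub>A\<^esub> z}\<rparr>"

definition ring_as_module :: "('a, 'm) ring_scheme \<Rightarrow> ('a, 'a) module" where
  "ring_as_module A =
    \<lparr>carrier = carrier A, monoid.mult = monoid.mult A, one = \<one>\<^bsub>A\<^esub>, zero = \<zero>\<^bsub>A\<^esub>,
      add = add A, smult = monoid.mult A\<rparr>"

definition finitely_generated_module ::
    "('a, 'm) ring_scheme \<Rightarrow> ('a, 'b, 'n) module_scheme \<Rightarrow> bool" where
  "finitely_generated_module R M \<longleftrightarrow>
    module R M \<and>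
    (\<exists>S. finite S \<and> S \<subseteq> carrier M \<and>
      (\<forall>x\<in>carrier M. \<exists>c \<in> S \<rightarrow> carrier R. x = (\<Oplus>\<^bsub>M\<^esub>s\<in>S. c s \<odot>\<^bsub>M\<^esub> s)))"


section \<open>Basic facts\<close>

lemma intersection_of_carrier: "intersection_of R P (carrier R)"
  unfolding intersection_of_def by (intro exI[of _ "{}"]) auto

lemma weakly_left_jacobson_iff_proper:
  "weakly_left_jacobson R \<longleftrightarrow>
    (\<forall>I. prime_left_ideal I R \<and> I \<noteq> carrier R \<longrightarrow>
      intersection_of R (\<lambda>J. maximal_left_ideal J R) I)"
  unfolding weakly_left_jacobson_def using intersection_of_carrier by metis

lemma jacobson_iff_proper:
  "jacobson R \<longleftrightarrow>
    (\<forall>I. prime_two_sided_ideal I R \<and> I \<noteq> carrier R \<longrightarrow>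
      intersection_of R (\<lambda>J. left_primitive_ideal J R) I)"
  unfolding jacobson_def using intersection_of_carrier by metis

lemma (in ring) ring_center_cring: "cring (ring_center R)"
proof -
  let ?Z = "{z \<in> carrier R. \<forall>x\<in>carrier R. z \<otimes> x = x \<otimes> z}"
  have "subring ?Z R"
  proof (rule subringI)
    fix h assume h: "h \<in> ?Z"
    have "(\<ominus> h) \<otimes> x = x \<otimes> (\<ominus> h)" if "x \<in> carrier R" for x
      using h that l_minus[of h x] r_minus[of x h] by simp
    then show "\<ominus> h \<in> ?Z" using h by simp
  next
    fix h1 h2 assume "h1 \<in> ?Z" "h2 \<in> ?Z"
    then have h: "h1 \<in> carrier R" "h2 \<in> carrier R"
      and c1: "\<And>x. x \<in> carrier R \<Longrightarrow> h1 \<otimes> x = x \<otimes> h1"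
      and c2: "\<And>x. x \<in> carrier R \<Longrightarrow> h2 \<otimes> x = x \<otimes> h2" by blast+
    have "h1 \<otimes> h2 \<otimes> x = x \<otimes> (h1 \<otimes> h2)" if x: "x \<in> carrier R" for x
    proof -
      have "h1 \<otimes> h2 \<otimes> x = h1 \<otimes> (x \<otimes> h2)" by (simp only: m_assoc h x c2[OF x])
      also have "\<dots> = (x \<otimes> h1) \<otimes> h2" by (simp only: m_assoc[symmetric] h x c1[OF x])
      finally show ?thesis by (simp only: m_assoc h x)
    qed
    then show "h1 \<otimes> h2 \<in> ?Z" using h by simp
    have "(h1 \<oplus> h2) \<otimes> x = x \<otimes> (h1 \<oplus> h2)" if x: "x \<in> carrier R" for x
      by (simp only: l_distr r_distr h x c1[OF x] c2[OF x])
    then show "h1 \<oplus> h2 \<in> ?Z" using h by simp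
  qed auto
  then have "subcring ?Z R" by (rule subcringI) blast
  then show ?thesis
    unfolding ring_center_def by (subst (asm) subcring_iff) auto
qed

lemma (in ring) ring_as_module_over_center: "module (ring_center R) (ring_as_module R)"
proof -
  have [simp]: "carrier (ring_as_module R) = carrier R" "\<zero>\<^bsub>ring_as_module R\<^esub> = \<zero>"
    "x \<oplus>\<^bsub>ring_as_module R\<^esub> y = x \<oplus> y" "x \<odot>\<^bsub>ring_as_module R\<^esub> y = x \<otimes> y" for x y
    by (simp_all add: ring_as_module_def)
  have [simp]: "x \<oplus>\<^bsub>ring_center R\<^esub> y = x \<oplus> y" "x \<otimes>\<^bsub>ring_center R\<^esub> y = x \<otimes> y"
    "\<one>\<^bsub>ring_center R\<^esub> = \<one>" for x y
    by (simp_all add: ring_center_def)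
  have Z: "x \<in> carrier R" if "x \<in> carrier (ring_center R)" for x
    using that by (simp add: ring_center_def)
  have "abelian_group (ring_as_module R)"
  proof (rule abelian_groupI)
    fix x assume "x \<in> carrier (ring_as_module R)"
    then show "\<exists>y\<in>carrier (ring_as_module R). y \<oplus>\<^bsub>ring_as_module R\<^esub> x = \<zero>\<^bsub>ring_as_module R\<^esub>"
      by (intro bexI[of _ "\<ominus> x"]) (simp_all add: l_neg)
  qed (simp_all add: a_ac)
  then show ?thesis
    by (intro moduleI ring_center_cring) (simp_all add: Z l_distr r_distr m_assoc)
qed

lemma (in left_module) smult_l_null [simp]:
  assumes x: "x \<in> carrier M" shows "\<zero>\<^bsub>R\<^esub> \<odot>\<^bsub>M\<^esub> x = \<zero>\<^bsub>M\<^esub>"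
proof -
  have "\<zero>\<^bsub>R\<^esub> \<odot>\<^bsub>M\<^esub> x \<oplus>\<^bsub>M\<^esub> \<zero>\<^bsub>R\<^esub> \<odot>\<^bsub>M\<^esub> x = \<zero>\<^bsub>R\<^esub> \<odot>\<^bsub>M\<^esub> x"
    using smult_l_distr[of "\<zero>\<^bsub>R\<^esub>" "\<zero>\<^bsub>R\<^esub>" x] x by simp
  then show ?thesis
    using x M.add.r_cancel_one smult_closed R.zero_closed by blast
qed

lemma (in left_module) submoduleI:
  assumes "H \<subseteq> carrier M" "\<zero>\<^bsub>M\<^esub> \<in> H"
    and "\<And>a b. \<lbrakk>a \<in> H; b \<in> H\<rbrakk> \<Longrightarrow> a \<oplus>\<^bsub>M\<^esub> b \<in> H"
    and smult: "\<And>a x. \<lbrakk>a \<in> carrier R; x \<in> H\<rbrakk> \<Longrightarrow> a \<odot>\<^bsub>M\<^esub> x \<in> H"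
  shows "submodule H R M"
proof -
  have "\<ominus>\<^bsub>M\<^esub> x \<in> H" if "x \<in> H" for x
  proof -
    have x: "x \<in> carrier M" using that assms(1) by auto
    have "(\<ominus>\<^bsub>R\<^esub> \<one>\<^bsub>R\<^esub>) \<odot>\<^bsub>M\<^esub> x \<oplus>\<^bsub>M\<^esub> x = \<zero>\<^bsub>M\<^esub>"
      using smult_l_distr[of "\<ominus>\<^bsub>R\<^esub> \<one>\<^bsub>R\<^esub>" "\<one>\<^bsub>R\<^esub>" x] x by (simp add: R.l_neg)
    then have "\<ominus>\<^bsub>M\<^esub> x = (\<ominus>\<^bsub>R\<^esub> \<one>\<^bsub>R\<^esub>) \<odot>\<^bsub>M\<^esub> x"
      using x M.minus_equality by (metis R.a_inv_closed R.one_closed smult_closed)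
    then show ?thesis using smult[OF _ that] by simp
  qed
  then show ?thesis
    using assms unfolding submodule_def submodule_axioms_def
    by (intro conjI subgroup.intro) (auto simp: a_inv_def)
qed

theorem left_primitive_annihilator:
  fixes R :: "('a, 'm) ring_scheme" and M :: "('a, 'b, 'n) module_scheme"
  assumes simple: "simple_left_module R M"
  shows "left_primitive_ideal (annihilator R M) R"
proof -
  interpret left_module R M using simple by (simp add: simple_left_module_def)
  obtain m where m: "m \<in> carrier M" "m \<noteq> \<zero>\<^bsub>M\<^esub>"
    using simple M.zero_closed unfolding simple_left_module_def by blast
  let ?orb = "(\<lambda>a. a \<odot>\<^bsub>M\<^esub> m) ` carrier R"
  have "submodule ?orb R M"
  proof (rule submoduleI)
    show "?orb \<subseteq> carrier M" using m by auto
    have "\<zero>\<^bsub>M\<^esub> = \<zero>\<^bsub>R\<^esub> \<odot>\<^bsub>M\<^esub> m" using m by simp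
    then show "\<zero>\<^bsub>M\<^esub> \<in> ?orb" by auto
  next
    fix a b assume "a \<in> ?orb" "b \<in> ?orb"
    then show "a \<oplus>\<^bsub>M\<^esub> b \<in> ?orb"
      using m by (auto simp: smult_l_distr[symmetric])
  next
    fix a x assume "a \<in> carrier R" "x \<in> ?orb"
    then show "a \<odot>\<^bsub>M\<^esub> x \<in> ?orb"
      using m by (auto simp: smult_assoc1[symmetric])
  qed
  moreover have "m \<in> ?orb" using m smult_one R.one_closed by (metis imageI)
  ultimately have orb: "?orb = carrier M"
    using simple m unfolding simple_left_module_def by auto
  define f where "f y = {a \<in> carrier R. a \<odot>\<^bsub>M\<^esub> m = y}" for y
  have inj: "inj_on f (carrier M)"
  proof (rule inj_onI)
    fix x y assume x: "x \<in> carrier M" and eq: "f x = f y"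
    from x orb obtain a where "a \<in> carrier R" "x = a \<odot>\<^bsub>M\<^esub> m" by (metis imageE)
    then have "a \<in> f x" by (simp add: f_def)
    with eq show "x = y" unfolding f_def by auto
  qed
  define g where "g = the_inv_into (carrier M) f"
  have gf: "g (f x) = x" if "x \<in> carrier M" for x
    using the_inv_into_f_f[OF inj that] by (simp add: g_def)
  define N :: "('a, 'a set) module" where
    "N = \<lparr>carrier = f ` carrier M, monoid.mult = undefined, one = undefined, zero = f \<zero>\<^bsub>M\<^esub>,
      add = (\<lambda>X Y. f (g X \<oplus>\<^bsub>M\<^esub> g Y)), smult = (\<lambda>a X. f (a \<odot>\<^bsub>M\<^esub> g X))\<rparr>"
  have N [simp]: "carrier N = f ` carrier M" "\<zero>\<^bsub>N\<^esub> = f \<zero>\<^bsub>M\<^esub>"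
    "X \<oplus>\<^bsub>N\<^esub> Y = f (g X \<oplus>\<^bsub>M\<^esub> g Y)" "a \<odot>\<^bsub>N\<^esub> X = f (a \<odot>\<^bsub>M\<^esub> g X)" for X Y a
    by (simp_all add: N_def)
  have "abelian_group N"
  proof (rule abelian_groupI)
    fix X assume "X \<in> carrier N"
    then obtain x where x: "x \<in> carrier M" "X = f x" by auto
    then show "\<exists>Y\<in>carrier N. Y \<oplus>\<^bsub>N\<^esub> X = \<zero>\<^bsub>N\<^esub>"
      by (intro bexI[of _ "f (\<ominus>\<^bsub>M\<^esub> x)"]) (auto simp: gf M.l_neg)
  qed (auto simp: gf M.a_ac)
  then have N_mod: "left_module R N"
    by (intro left_module.intro left_module_axioms.intro R.ring_axioms)
      (auto simp: gf smult_l_distr smult_r_distr smult_assoc1)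
  have "carrier N \<noteq> {\<zero>\<^bsub>N\<^esub>}"
    using m inj by (auto simp: inj_on_def)
  moreover have "H = {\<zero>\<^bsub>N\<^esub>} \<or> H = carrier N" if H: "submodule H R N" for H
  proof -
    interpret H: subgroup H "add_monoid N" using H by (simp add: submodule_def)
    have HN: "H \<subseteq> f ` carrier M" using H.subset by simp
    have smult: "a \<odot>\<^bsub>N\<^esub> X \<in> H" if "a \<in> carrier R" "X \<in> H" for a X
      using submodule.smult_closed[OF H that] .
    let ?K = "{x \<in> carrier M. f x \<in> H}"
    have H_eq: "H = f ` ?K" using HN by auto
    have "submodule ?K R M"
    proof (rule submoduleI)
      fix x y assume "x \<in> ?K" "y \<in> ?K"
      then show "x \<oplus>\<^bsub>M\<^esub> y \<in> ?K" using H.m_closed[of "f x" "f y"] by (auto simp: gf)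
    next
      fix a x assume "a \<in> carrier R" "x \<in> ?K"
      then show "a \<odot>\<^bsub>M\<^esub> x \<in> ?K" using smult[of a "f x"] by (auto simp: gf)
    qed (use H.one_closed in auto)
    then have "?K = {\<zero>\<^bsub>M\<^esub>} \<or> ?K = carrier M"
      using simple unfolding simple_left_module_def by blast
    then show ?thesis
    proof
      assume "?K = {\<zero>\<^bsub>M\<^esub>}"
      with H_eq have "H = f ` {\<zero>\<^bsub>M\<^esub>}" by (simp only:)
      then show ?thesis by simp
    next
      assume "?K = carrier M"
      with H_eq have "H = f ` carrier M" by (simp only:)
      then show ?thesis by simp
    qed
  qed
  ultimately have "simple_left_module R N"
    using N_mod unfolding simple_left_module_def by blast
  moreover have "annihilator R M = annihilator R N"
    using inj by (auto simp: annihilator_def gf inj_on_eq_iff)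
  ultimately show ?thesis unfolding left_primitive_ideal_def by blast
qed

end

theory Submission
  imports Defs
begin

text \<open>A two-sided prime is a prime left ideal, and a maximal left ideal containing it also contains
  it in its core, which is the annihilator of a simple module; so weakly left Jacobson implies
  Jacobson for every ring.

  Conversely, let \<open>I\<close> be a prime left ideal and \<open>P = {a. aA \<subseteq> I}\<close>, a prime ideal. Localizing \<open>A / P\<close> at
  the nonzero central elements gives a simple artinian ring, in which the image of \<open>I\<close> has a complement
  and hence is a left annihilator; clearing denominators, for \<open>b \<notin> I\<close> there is \<open>v\<close> with \<open>I v \<subseteq> P\<close> and
  \<open>b v \<notin> P\<close>. As \<open>P\<close> is an intersection of annihilators of simple modules, some simple module killed
  by \<open>P\<close> has an element \<open>m\<close> with \<open>b v m \<noteq> 0\<close>, and the annihilator of \<open>v m\<close> is a maximal left ideal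
  that contains \<open>I\<close> but not \<open>b\<close>. Working in \<open>A\<close> modulo \<open>P\<close>, with left ideals closed under division by
  central elements outside \<open>P\<close>, avoids the quotient and the localization.\<close>

section \<open>Left ideals\<close>

text \<open>For a left ideal \<open>L\<close> this is the largest two-sided ideal inside
  \<open>L\<close>, and equally the annihilator of the left module \<open>R / L\<close>.\<close>

definition core :: "('a, 'm) ring_scheme \<Rightarrow> 'a set \<Rightarrow> 'a set" where
  "core R L = {a \<in> carrier R. \<forall>x\<in>carrier R. a \<otimes>\<^bsub>R\<^esub> x \<in> L}"

context ring
begin

lemma left_idealI:
  assumes "L \<subseteq> carrier R" "\<zero> \<in> L"
    and "\<And>x y. \<lbrakk>x \<in> L; y \<in> L\<rbrakk> \<Longrightarrow> x \<oplus> y \<in> L"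
    and mult: "\<And>a x. \<lbrakk>a \<in> carrier R; x \<in> L\<rbrakk> \<Longrightarrow> a \<otimes> x \<in> L"
  shows "left_ideal L R"
proof -
  have "\<ominus> x \<in> L" if "x \<in> L" for x
    using mult[of "\<ominus> \<one>" x] that assms(1) by (auto simp: l_minus)
  then have "additive_subgroup L R"
    using assms by (intro additive_subgroup.intro subgroup.intro) (auto simp: a_inv_def)
  then show ?thesis
    by (intro left_ideal.intro left_ideal_axioms.intro ring_axioms mult)
qed

lemma
  assumes "left_ideal L R"
  shows left_ideal_carrier: "x \<in> L \<Longrightarrow> x \<in> carrier R"
    and left_ideal_zero: "\<zero> \<in> L"
    and left_ideal_add: "\<lbrakk>x \<in> L; y \<in> L\<rbrakk> \<Longrightarrow> x \<oplus> y \<in> L"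
    and left_ideal_minus: "\<lbrakk>x \<in> L; y \<in> L\<rbrakk> \<Longrightarrow> x \<ominus> y \<in> L"
    and left_ideal_mult: "\<lbrakk>a \<in> carrier R; x \<in> L\<rbrakk> \<Longrightarrow> a \<otimes> x \<in> L"
proof -
  interpret left_ideal L R by fact
  show "x \<in> L \<Longrightarrow> x \<in> carrier R" "\<zero> \<in> L" "\<lbrakk>x \<in> L; y \<in> L\<rbrakk> \<Longrightarrow> x \<oplus> y \<in> L"
    "\<lbrakk>a \<in> carrier R; x \<in> L\<rbrakk> \<Longrightarrow> a \<otimes> x \<in> L"
    using a_Hcarr I_l_closed by auto
  show "\<lbrakk>x \<in> L; y \<in> L\<rbrakk> \<Longrightarrow> x \<ominus> y \<in> L"
    unfolding minus_eq by simp
qed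

lemma ideal_left_ideal: "ideal I R \<Longrightarrow> left_ideal I R"
  by (simp add: ideal_def ideal_axioms_def left_ideal_axioms_def left_ideal_def)

lemma left_ideal_cancel_right:
  assumes "left_ideal L R" "x \<in> carrier R" "y \<in> carrier R" "x \<oplus> y \<in> L" "y \<in> L"
  shows "x \<in> L"
proof -
  have "x = (x \<oplus> y) \<ominus> y" using assms by (simp add: minus_eq a_assoc r_neg)
  then show ?thesis using left_ideal_minus[OF assms(1,4,5)] by simp
qed

lemma left_ideal_carrier_iff: "left_ideal L R \<Longrightarrow> L = carrier R \<longleftrightarrow> \<one> \<in> L"
  using left_ideal_mult[of L _ \<one>] left_ideal_carrier[of L] by auto

lemma left_ideal_Int: "\<lbrakk>left_ideal L R; left_ideal M R\<rbrakk> \<Longrightarrow> left_ideal (L \<inter> M) R"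
  by (rule left_idealI)
    (auto dest: left_ideal_carrier intro: left_ideal_zero left_ideal_add left_ideal_mult)

lemma left_ideal_mult_right:
  assumes L: "left_ideal L R" and u: "u \<in> carrier R"
  shows "left_ideal ((\<lambda>x. x \<otimes> u) ` L) R"
proof (rule left_idealI)
  note c = left_ideal_carrier[OF L]
  show "(\<lambda>x. x \<otimes> u) ` L \<subseteq> carrier R" using c u by auto
  show "\<zero> \<in> (\<lambda>x. x \<otimes> u) ` L" using u left_ideal_zero[OF L] by (intro rev_image_eqI[of \<zero>]) auto
  show "x \<oplus> y \<in> (\<lambda>x. x \<otimes> u) ` L"
    if "x \<in> (\<lambda>x. x \<otimes> u) ` L" "y \<in> (\<lambda>x. x \<otimes> u) ` L" for x y
    using that c u by (auto simp: l_distr[symmetric] intro!: imageI left_ideal_add[OF L])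
  show "a \<otimes> x \<in> (\<lambda>x. x \<otimes> u) ` L" if "a \<in> carrier R" "x \<in> (\<lambda>x. x \<otimes> u) ` L" for a x
    using that c u by (auto simp: m_assoc[symmetric] intro!: imageI left_ideal_mult[OF L])
qed

lemma left_ideal_sum:
  assumes L: "left_ideal L R" and M: "left_ideal M R"
  shows "left_ideal (L <+>\<^bsub>R\<^esub> M) R"
proof (rule left_idealI)
  note c = left_ideal_carrier[OF L] left_ideal_carrier[OF M]
  have mem: "x \<in> L <+>\<^bsub>R\<^esub> M \<longleftrightarrow> (\<exists>l\<in>L. \<exists>m\<in>M. x = l \<oplus> m)" for x
    by (auto simp: set_add_def')
  show "L <+>\<^bsub>R\<^esub> M \<subseteq> carrier R" using c by (auto simp: mem)
  show "\<zero> \<in> L <+>\<^bsub>R\<^esub> M" using left_ideal_zero[OF L] left_ideal_zero[OF M] by (force simp: mem)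
  show "x \<oplus> y \<in> L <+>\<^bsub>R\<^esub> M" if xy: "x \<in> L <+>\<^bsub>R\<^esub> M" "y \<in> L <+>\<^bsub>R\<^esub> M" for x y
  proof -
    obtain l m l' m' where *: "l \<in> L" "m \<in> M" "x = l \<oplus> m" "l' \<in> L" "m' \<in> M" "y = l' \<oplus> m'"
      using xy by (auto simp: mem)
    then have "x \<oplus> y = (l \<oplus> l') \<oplus> (m \<oplus> m')" using c by (simp add: a_ac)
    moreover have "l \<oplus> l' \<in> L" "m \<oplus> m' \<in> M"
      using * left_ideal_add[OF L] left_ideal_add[OF M] by auto
    ultimately show ?thesis unfolding mem by blast
  qed
  show "a \<otimes> x \<in> L <+>\<^bsub>R\<^esub> M" if ax: "a \<in> carrier R" "x \<in> L <+>\<^bsub>R\<^esub> M" for a x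
  proof -
    obtain l m where *: "l \<in> L" "m \<in> M" "x = l \<oplus> m" using ax by (auto simp: mem)
    then have "a \<otimes> x = a \<otimes> l \<oplus> a \<otimes> m" using c ax by (simp add: r_distr)
    moreover have "a \<otimes> l \<in> L" "a \<otimes> m \<in> M"
      using * ax left_ideal_mult[OF L] left_ideal_mult[OF M] by auto
    ultimately show ?thesis unfolding mem by blast
  qed
qed

lemma subset_sum:
  assumes L: "left_ideal L R" and M: "left_ideal M R"
  shows "L \<subseteq> L <+>\<^bsub>R\<^esub> M" "M \<subseteq> L <+>\<^bsub>R\<^esub> M"
proof -
  show "L \<subseteq> L <+>\<^bsub>R\<^esub> M"
    using left_ideal_zero[OF M] left_ideal_carrier[OF L] by (force simp: set_add_def')
  show "M \<subseteq> L <+>\<^bsub>R\<^esub> M"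
    using left_ideal_zero[OF L] left_ideal_carrier[OF M] by (force simp: set_add_def')
qed

lemma core_subset: "core R L \<subseteq> L"
  by (auto simp: core_def dest!: bspec[of _ _ \<one>])

lemma core_ideal:
  assumes L: "left_ideal L R"
  shows "ideal (core R L) R"
proof -
  have left: "left_ideal (core R L) R"
    by (rule left_idealI)
      (auto simp: core_def m_assoc l_distr left_ideal_zero[OF L] left_ideal_add[OF L]
        left_ideal_mult[OF L])
  have right: "a \<otimes> x \<in> core R L" if "a \<in> core R L" "x \<in> carrier R" for a x
    using that by (auto simp: core_def m_assoc)
  interpret left_ideal "core R L" R by fact
  show ?thesis by (rule idealI[OF ring_axioms a_subgroup I_l_closed right])
qed

text \<open>If \<open>b\<close> is outside the core, some \<open>b y\<close> is outside
  \<open>I\<close>. For every \<open>x\<close> the products \<open>(a x) w (b y)\<close> all lie in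
  \<open>I\<close>, so primeness of \<open>I\<close> yields \<open>a x \<in> I\<close>, which puts
  \<open>a\<close> in the core.\<close>

lemma core_prime:
  assumes "prime_left_ideal I R"
  shows "prime_two_sided_ideal (core R I) R"
proof -
  have I: "left_ideal I R"
    and prime: "\<And>a b. \<lbrakk>a \<in> carrier R; b \<in> carrier R; \<forall>x\<in>carrier R. a \<otimes> x \<otimes> b \<in> I\<rbrakk> \<Longrightarrow> a \<in> I \<or> b \<in> I"
    using assms unfolding prime_left_ideal_def prime_condition_def by blast+
  have "a \<in> core R I \<or> b \<in> core R I"
    if ab: "a \<in> carrier R" "b \<in> carrier R" and *: "\<forall>x\<in>carrier R. a \<otimes> x \<otimes> b \<in> core R I" for a b
  proof (cases "b \<in> core R I")
    case False
    then obtain y where y: "y \<in> carrier R" "b \<otimes> y \<notin> I" using ab by (auto simp: core_def)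
    have "a \<otimes> x \<in> I" if x: "x \<in> carrier R" for x
    proof -
      have "a \<otimes> x \<otimes> w \<otimes> (b \<otimes> y) \<in> I" if w: "w \<in> carrier R" for w
      proof -
        have "a \<otimes> (x \<otimes> w) \<otimes> b \<otimes> y \<in> I" using * x w y by (auto simp: core_def)
        then show ?thesis using ab x w y by (simp add: m_assoc)
      qed
      then show ?thesis using prime[of "a \<otimes> x" "b \<otimes> y"] ab x y by auto
    qed
    then show ?thesis using ab by (auto simp: core_def)
  qed simp
  then show ?thesis
    unfolding prime_two_sided_ideal_def prime_condition_def using core_ideal[OF I] by blast
qed

end

section \<open>Maximal left ideals and simple modules\<close>

text \<open>A left ideal \<open>J\<close> above the annihilator of \<open>m\<close> gives the
  submodule \<open>J m\<close>, which is zero or everything. In the second case some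
  \<open>j \<in> J\<close> fixes \<open>m\<close>, so \<open>1 - j\<close> annihilates
  \<open>m\<close> and hence \<open>1 \<in> J\<close>.\<close>

lemma maximal_left_ideal_point_annihilator:
  assumes simple: "simple_left_module R M" and m: "m \<in> carrier M" "m \<noteq> \<zero>\<^bsub>M\<^esub>"
  shows "maximal_left_ideal {x \<in> carrier R. x \<odot>\<^bsub>M\<^esub> m = \<zero>\<^bsub>M\<^esub>} R"
    (is "maximal_left_ideal ?N R")
proof -
  interpret left_module R M using simple by (simp add: simple_left_module_def)
  have smult_zero: "a \<odot>\<^bsub>M\<^esub> \<zero>\<^bsub>M\<^esub> = \<zero>\<^bsub>M\<^esub>" if "a \<in> carrier R" for a
    using smult_r_distr[of a "\<zero>\<^bsub>M\<^esub>" "\<zero>\<^bsub>M\<^esub>"] that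
    by (metis M.add.r_cancel_one M.zero_closed M.r_zero smult_closed)
  have N: "left_ideal ?N R"
    by (rule R.left_idealI) (auto simp: m smult_l_distr smult_assoc1 smult_zero)
  show ?thesis
  proof (intro maximal_left_ideal.intro maximal_left_ideal_axioms.intro N)
    show "carrier R \<noteq> ?N" using m by (auto dest!: equalityD1 subsetD[of _ _ "\<one>\<^bsub>R\<^esub>"])
  next
    fix J assume J: "left_ideal J R" "?N \<subseteq> J" "J \<subseteq> carrier R"
    let ?H = "(\<lambda>a. a \<odot>\<^bsub>M\<^esub> m) ` J"
    have J_c: "a \<in> J \<Longrightarrow> a \<in> carrier R" for a using J(3) by auto
    have "submodule ?H R M"
    proof (rule submoduleI)
      show "\<zero>\<^bsub>M\<^esub> \<in> ?H" using R.left_ideal_zero[OF J(1)] m by (force intro: image_eqI)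
    qed (auto simp: m J_c smult_l_distr[symmetric] smult_assoc1[symmetric]
        intro!: imageI R.left_ideal_add[OF J(1)] R.left_ideal_mult[OF J(1)])
    then consider "?H = {\<zero>\<^bsub>M\<^esub>}" | "?H = carrier M"
      using simple unfolding simple_left_module_def by blast
    then show "J = ?N \<or> J = carrier R"
    proof cases
      case 1
      then have "J \<subseteq> ?N" using J_c by blast
      then show ?thesis using J by auto
    next
      case 2
      then have "m \<in> ?H" using m by simp
      then obtain j where j: "j \<in> J" "j \<odot>\<^bsub>M\<^esub> m = m" by (metis imageE)
      have jc: "j \<in> carrier R" using j J_c by simp
      have "(\<one>\<^bsub>R\<^esub> \<ominus>\<^bsub>R\<^esub> j) \<oplus>\<^bsub>R\<^esub> j = \<one>\<^bsub>R\<^esub>"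
        using jc by (simp add: R.minus_eq R.a_assoc R.l_neg)
      then have "(\<one>\<^bsub>R\<^esub> \<ominus>\<^bsub>R\<^esub> j) \<odot>\<^bsub>M\<^esub> m \<oplus>\<^bsub>M\<^esub> j \<odot>\<^bsub>M\<^esub> m = m"
        using jc m smult_l_distr[of "\<one>\<^bsub>R\<^esub> \<ominus>\<^bsub>R\<^esub> j" j m] by simp
      then have "(\<one>\<^bsub>R\<^esub> \<ominus>\<^bsub>R\<^esub> j) \<odot>\<^bsub>M\<^esub> m = \<zero>\<^bsub>M\<^esub>"
        using j(2) jc m M.add.r_cancel_one[of m "(\<one>\<^bsub>R\<^esub> \<ominus>\<^bsub>R\<^esub> j) \<odot>\<^bsub>M\<^esub> m"] by simp
      then have "\<one>\<^bsub>R\<^esub> \<ominus>\<^bsub>R\<^esub> j \<in> J" using J j J_c by auto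
      then have "\<one>\<^bsub>R\<^esub> \<in> J"
        using R.left_ideal_add[OF J(1) _ j(1)] \<open>(\<one>\<^bsub>R\<^esub> \<ominus>\<^bsub>R\<^esub> j) \<oplus>\<^bsub>R\<^esub> j = \<one>\<^bsub>R\<^esub>\<close> by metis
      then show ?thesis using R.left_ideal_carrier_iff[OF J(1)] by simp
    qed
  qed
qed

text \<open>The core of \<open>L\<close> is the annihilator of the simple module
  \<open>R / L\<close>. The module is built from the cosets \<open>q x\<close>, so that its elements
  have the type fixed in \<open>left_primitive_ideal\<close>.\<close>

lemma (in ring) core_maximal_left_primitive:
  assumes "maximal_left_ideal L R"
  shows "left_primitive_ideal (core R L) R"
proof -
  interpret L: maximal_left_ideal L R by fact
  have L: "left_ideal L R" by unfold_locales
  define q where "q x = {y \<in> carrier R. y \<ominus> x \<in> L}" for x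
  have q_eq: "q x = q y \<longleftrightarrow> x \<ominus> y \<in> L" if xy: "x \<in> carrier R" "y \<in> carrier R" for x y
  proof
    assume "q x = q y"
    moreover have "x \<in> q x" using xy left_ideal_zero[OF L] by (simp add: q_def minus_eq r_neg)
    ultimately show "x \<ominus> y \<in> L" by (auto simp: q_def)
  next
    assume *: "x \<ominus> y \<in> L"
    have "z \<ominus> x \<in> L \<longleftrightarrow> z \<ominus> y \<in> L" if z: "z \<in> carrier R" for z
    proof -
      have "z \<ominus> y = (z \<ominus> x) \<oplus> (x \<ominus> y)"
        using xy z by (simp add: minus_eq a_ac l_neg r_neg2)
      then show ?thesis
        using left_ideal_add[OF L _ *, of "z \<ominus> x"]
          left_ideal_cancel_right[OF L _ _ _ *, of "z \<ominus> x"] xy z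
        by (metis minus_closed)
    qed
    then show "q x = q y" by (auto simp: q_def)
  qed
  \<comment> \<open>A choice of coset representatives. The operations of \<open>M\<close> are
    written with \<open>r\<close>; the facts \<open>add\<close> and \<open>smult\<close> show that
    they do not depend on the choice.\<close>
  define r where "r X = (SOME x. x \<in> carrier R \<and> q x = X)" for X
  have r: "r (q x) \<in> carrier R" "q (r (q x)) = q x" if "x \<in> carrier R" for x
    using someI[of "\<lambda>y. y \<in> carrier R \<and> q y = q x" x] that by (auto simp: r_def)
  have q_diff: "r (q x) \<ominus> x \<in> L" if "x \<in> carrier R" for x
    using r[OF that] that q_eq[of "r (q x)" x] by simp
  define M :: "('a, 'a set) module" where
    "M = \<lparr>carrier = q ` carrier R, monoid.mult = undefined, one = undefined, zero = q \<zero>,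
      add = (\<lambda>X Y. q (r X \<oplus> r Y)), smult = (\<lambda>a X. q (a \<otimes> r X))\<rparr>"
  have M: "carrier M = q ` carrier R" "\<zero>\<^bsub>M\<^esub> = q \<zero>" by (simp_all add: M_def)
  have add: "q x \<oplus>\<^bsub>M\<^esub> q y = q (x \<oplus> y)" if xy: "x \<in> carrier R" "y \<in> carrier R" for x y
  proof -
    have "r (q x) \<ominus> x \<in> L" "r (q y) \<ominus> y \<in> L" using xy r q_diff by auto
    then have "(r (q x) \<ominus> x) \<oplus> (r (q y) \<ominus> y) \<in> L" by (rule left_ideal_add[OF L])
    also have "(r (q x) \<ominus> x) \<oplus> (r (q y) \<ominus> y) = (r (q x) \<oplus> r (q y)) \<ominus> (x \<oplus> y)"
      using xy r by (simp add: minus_eq minus_add a_ac)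
    finally show ?thesis using xy r by (simp add: M_def q_eq)
  qed
  have smult: "a \<odot>\<^bsub>M\<^esub> q x = q (a \<otimes> x)" if ax: "a \<in> carrier R" "x \<in> carrier R" for a x
  proof -
    have "r (q x) \<ominus> x \<in> L" using ax q_diff by auto
    then have "a \<otimes> (r (q x) \<ominus> x) \<in> L" by (rule left_ideal_mult[OF L ax(1)])
    then show ?thesis using ax r by (simp add: M_def q_eq minus_eq r_distr r_minus)
  qed
  have zero: "q x = q \<zero> \<longleftrightarrow> x \<in> L" if "x \<in> carrier R" for x
    using that by (simp add: q_eq minus_eq)
  have zero': "q x = \<zero>\<^bsub>M\<^esub>" if "x \<in> L" for x
    using zero that left_ideal_carrier[OF L that] by (simp add: M)
  have "abelian_group M"
  proof (rule abelian_groupI)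
    fix X assume "X \<in> carrier M"
    then obtain x where x: "x \<in> carrier R" "X = q x" by (auto simp: M)
    then show "\<exists>Y\<in>carrier M. Y \<oplus>\<^bsub>M\<^esub> X = \<zero>\<^bsub>M\<^esub>"
      by (intro bexI[of _ "q (\<ominus> x)"]) (auto simp: M add l_neg)
  qed (auto simp: M add a_ac)
  then have mod: "left_module R M"
    by (intro left_module.intro left_module_axioms.intro ring_axioms)
      (auto simp: M add smult l_distr r_distr m_assoc)
  interpret M: left_module R M by fact
  have "H = {\<zero>\<^bsub>M\<^esub>} \<or> H = carrier M" if H: "submodule H R M" for H
  proof -
    interpret H: subgroup H "add_monoid M" using H by (simp add: submodule_def)
    have HM: "H \<subseteq> q ` carrier R" using H.subset by (simp add: M)
    \<comment> \<open>The preimage of a submodule is a left ideal above \<open>L\<close>, so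
      maximality of \<open>L\<close> leaves only two submodules.\<close>
    let ?J = "{x \<in> carrier R. q x \<in> H}"
    have H_eq: "H = q ` ?J" using HM by auto
    have "left_ideal ?J R"
    proof (rule left_idealI)
      show "\<zero> \<in> ?J" using H.one_closed by (simp add: M)
      show "x \<oplus> y \<in> ?J" if "x \<in> ?J" "y \<in> ?J" for x y
        using H.m_closed[of "q x" "q y"] that by (simp add: add)
      show "a \<otimes> x \<in> ?J" if "a \<in> carrier R" "x \<in> ?J" for a x
        using submodule.smult_closed[OF H, of a "q x"] that by (simp add: smult)
    qed auto
    moreover have "L \<subseteq> ?J"
      using H.one_closed zero' left_ideal_carrier[OF L] by auto
    ultimately consider "?J = L" | "?J = carrier R" using L.I_maximal[of ?J] by auto
    then show ?thesis
    proof cases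
      case 1
      then have "H = q ` L" using H_eq by simp
      also have "\<dots> = {\<zero>\<^bsub>M\<^esub>}"
        using zero' left_ideal_zero[OF L] by (auto intro: rev_image_eqI[of \<zero>])
      finally show ?thesis by simp
    next
      case 2
      then show ?thesis using H_eq M by simp
    qed
  qed
  moreover have "carrier M \<noteq> {\<zero>\<^bsub>M\<^esub>}"
    using zero[of \<one>] left_ideal_carrier_iff[OF L] L.I_notcarr by (auto simp: M)
  ultimately have "simple_left_module R M"
    using mod unfolding simple_left_module_def by blast
  moreover have "core R L = annihilator R M"
    by (simp add: core_def annihilator_def M smult zero cong: conj_cong)
  ultimately show ?thesis unfolding left_primitive_ideal_def by blast
qed

text \<open>Each \<open>core R J\<close> lies between \<open>P\<close> and the maximal left ideal
  \<open>J\<close>, because \<open>P\<close> is two-sided. Replacing every \<open>J\<close> by its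
  core therefore leaves the intersection equal to \<open>P\<close>.\<close>

lemma (in ring) weakly_left_jacobson_imp_jacobson:
  assumes wlj: "weakly_left_jacobson R"
  shows "jacobson R"
  unfolding jacobson_def
proof (intro allI impI)
  fix P assume P: "prime_two_sided_ideal P R"
  then interpret ideal P R by (simp add: prime_two_sided_ideal_def)
  have "prime_left_ideal P R"
    using P ideal_left_ideal by (auto simp: prime_two_sided_ideal_def prime_left_ideal_def)
  then obtain F where F: "\<forall>J\<in>F. maximal_left_ideal J R" "P = carrier R \<inter> \<Inter>F"
    using wlj unfolding weakly_left_jacobson_def intersection_of_def by blast
  have "P = carrier R \<inter> \<Inter>(core R ` F)"
  proof
    have "P \<subseteq> core R J" if "J \<in> F" for J
    proof -
      have "P \<subseteq> J" using F(2) that by blast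
      then show ?thesis unfolding core_def using I_r_closed a_Hcarr by blast
    qed
    then show "P \<subseteq> carrier R \<inter> \<Inter>(core R ` F)" using a_Hcarr by auto
    show "carrier R \<inter> \<Inter>(core R ` F) \<subseteq> P" using F(2) core_subset by blast
  qed
  moreover have "\<forall>Q\<in>core R ` F. left_primitive_ideal Q R"
    using F(1) core_maximal_left_primitive by blast
  ultimately show "intersection_of R (\<lambda>J. left_primitive_ideal J R) P"
    unfolding intersection_of_def by blast
qed

section \<open>Spans over the center\<close>

context ring
begin

abbreviation center :: "'a set" where
  "center \<equiv> carrier (ring_center R)"

text \<open>The generators form a list, so that the recursion singles out a leading coefficient, as
  in an echelon form.\<close>

primrec center_span :: "'a list \<Rightarrow> 'a set" where
  "center_span [] = {\<zero>}"
| "center_span (g # gs) = {z \<otimes> g \<oplus> y | z y. z \<in> center \<and> y \<in> center_span gs}"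

lemma center_carrier: "z \<in> center \<Longrightarrow> z \<in> carrier R"
  by (simp add: ring_center_def)

lemma center_commute: "\<lbrakk>z \<in> center; x \<in> carrier R\<rbrakk> \<Longrightarrow> z \<otimes> x = x \<otimes> z"
  by (simp add: ring_center_def)

lemma one_center: "\<one> \<in> center"
  by (simp add: ring_center_def)

lemma center_mult:
  assumes "z \<in> center" "w \<in> center"
  shows "z \<otimes> w \<in> center"
  using cring.cring_simprules(5)[OF ring_center_cring, OF assms] by (simp add: ring_center_def)

lemma center_minus:
  assumes "z \<in> center" "w \<in> center"
  shows "z \<ominus> w \<in> center"
proof -
  have "(z \<ominus> w) \<otimes> x = x \<otimes> (z \<ominus> w)" if x: "x \<in> carrier R" for x
    using assms[THEN center_carrier] x center_commute[OF assms(1) x] center_commute[OF assms(2) x]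
    by (simp add: minus_eq l_distr r_distr l_minus r_minus)
  then show ?thesis using assms[THEN center_carrier] by (simp add: ring_center_def)
qed

lemma center_span_carrier: "set gs \<subseteq> carrier R \<Longrightarrow> center_span gs \<subseteq> carrier R"
  by (induction gs) (auto intro!: a_closed m_closed intro: center_carrier)

text \<open>Taking \<open>z = b\<close> and \<open>w = a\<close> makes the coefficient of
  \<open>g\<close> vanish: this is the elimination step of Gaussian elimination without
  division.\<close>

lemma minus_mult_cross:
  assumes zw: "z \<in> center" "w \<in> center" and ab: "a \<in> carrier R" "b \<in> carrier R"
    and g: "g \<in> carrier R" and xy: "x \<in> carrier R" "y \<in> carrier R"
  shows "z \<otimes> (a \<otimes> g \<oplus> x) \<ominus> w \<otimes> (b \<otimes> g \<oplus> y)
    = (z \<otimes> a \<ominus> w \<otimes> b) \<otimes> g \<oplus> (z \<otimes> x \<ominus> w \<otimes> y)"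
  using zw[THEN center_carrier] ab g xy
  by (simp add: minus_eq l_distr r_distr l_minus r_minus minus_add m_assoc a_ac)

lemma center_span_cross:
  assumes "set gs \<subseteq> carrier R" "z \<in> center" "w \<in> center" "x \<in> center_span gs" "y \<in> center_span gs"
  shows "z \<otimes> x \<ominus> w \<otimes> y \<in> center_span gs"
  using assms
proof (induction gs arbitrary: x y)
  case Nil
  then show ?case using center_carrier by (simp add: minus_eq)
next
  case (Cons g gs)
  obtain a x' where x: "x = a \<otimes> g \<oplus> x'" "a \<in> center" "x' \<in> center_span gs"
    using Cons.prems by auto
  obtain b y' where y: "y = b \<otimes> g \<oplus> y'" "b \<in> center" "y' \<in> center_span gs"
    using Cons.prems by auto
  have c: "x' \<in> carrier R" "y' \<in> carrier R"
    using x y center_span_carrier[of gs] Cons.prems by auto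
  have "z \<otimes> x \<ominus> w \<otimes> y = (z \<otimes> a \<ominus> w \<otimes> b) \<otimes> g \<oplus> (z \<otimes> x' \<ominus> w \<otimes> y')"
    unfolding x y using Cons.prems x y c center_carrier by (intro minus_mult_cross) auto
  moreover have "z \<otimes> a \<ominus> w \<otimes> b \<in> center"
    using Cons.prems x y by (intro center_minus center_mult)
  moreover have "z \<otimes> x' \<ominus> w \<otimes> y' \<in> center_span gs"
    using Cons x y by auto
  ultimately show ?case by auto
qed

text \<open>Induction on the finite generating set turns the sums over it into recursive spans; one
  list serves all coefficient functions.\<close>

lemma finitely_generated_center_span:
  assumes "finitely_generated_module (ring_center R) (ring_as_module R)"
  obtains gs where "set gs \<subseteq> carrier R" "carrier R \<subseteq> center_span gs"
proof -
  interpret M: module "ring_center R" "ring_as_module R"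
    by (rule ring_as_module_over_center)
  have [simp]: "carrier (ring_as_module R) = carrier R" "\<zero>\<^bsub>ring_as_module R\<^esub> = \<zero>"
    "x \<oplus>\<^bsub>ring_as_module R\<^esub> y = x \<oplus> y" "x \<odot>\<^bsub>ring_as_module R\<^esub> y = x \<otimes> y" for x y
    by (simp_all add: ring_as_module_def)
  have span: "\<exists>gs. set gs \<subseteq> carrier R \<and> (\<forall>c \<in> S \<rightarrow> center.
      (\<Oplus>\<^bsub>ring_as_module R\<^esub>s\<in>S. c s \<odot>\<^bsub>ring_as_module R\<^esub> s) \<in> center_span gs)"
    if "finite S" "S \<subseteq> carrier R" for S
    using that
  proof (induction S rule: finite_induct)
    case empty
    then show ?case by (intro exI[of _ "[]"]) auto
  next
    case (insert x S)
    then obtain gs where gs: "set gs \<subseteq> carrier R" and *: "\<And>c. c \<in> S \<rightarrow> center \<Longrightarrow>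
      (\<Oplus>\<^bsub>ring_as_module R\<^esub>s\<in>S. c s \<odot>\<^bsub>ring_as_module R\<^esub> s) \<in> center_span gs"
      by auto
    have "(\<Oplus>\<^bsub>ring_as_module R\<^esub>s\<in>insert x S. c s \<odot>\<^bsub>ring_as_module R\<^esub> s) \<in> center_span (x # gs)"
      if c: "c \<in> insert x S \<rightarrow> center" for c
    proof -
      have cc: "c s \<in> carrier R" if "s \<in> insert x S" for s
        using c that center_carrier by blast
      have "(\<Oplus>\<^bsub>ring_as_module R\<^esub>s\<in>insert x S. c s \<odot>\<^bsub>ring_as_module R\<^esub> s)
        = c x \<otimes> x \<oplus> (\<Oplus>\<^bsub>ring_as_module R\<^esub>s\<in>S. c s \<odot>\<^bsub>ring_as_module R\<^esub> s)"
        using insert.hyps insert.prems cc by (subst M.finsum_insert) auto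
      then show ?thesis using c * by auto
    qed
    then show ?case using gs insert.prems by (intro exI[of _ "x # gs"]) auto
  qed
  obtain S where S: "finite S" "S \<subseteq> carrier R" "\<And>x. x \<in> carrier R \<Longrightarrow>
      \<exists>c \<in> S \<rightarrow> center. x = (\<Oplus>\<^bsub>ring_as_module R\<^esub>s\<in>S. c s \<odot>\<^bsub>ring_as_module R\<^esub> s)"
    using assms unfolding finitely_generated_module_def by auto
  obtain gs where gs: "set gs \<subseteq> carrier R" and *: "\<And>c. c \<in> S \<rightarrow> center \<Longrightarrow>
      (\<Oplus>\<^bsub>ring_as_module R\<^esub>s\<in>S. c s \<odot>\<^bsub>ring_as_module R\<^esub> s) \<in> center_span gs"
    using span[OF S(1,2)] by metis
  have "x \<in> center_span gs" if "x \<in> carrier R" for x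
    using S(3)[OF that] * by metis
  then show thesis using that gs by blast
qed

end

section \<open>Saturated left ideals modulo a prime\<close>

text \<open>The setting for the converse direction: \<open>P\<close> will be the core of a proper
  prime left ideal.\<close>

locale prime_over_center = ring R for R (structure) +
  fixes P :: "'a set" and gs :: "'a list"
  assumes P_prime: "prime_two_sided_ideal P R"
    and P_proper: "P \<noteq> carrier R"
    and generators: "set gs \<subseteq> carrier R" "carrier R \<subseteq> center_span gs"
begin

lemma P_left: "left_ideal P R"
  using P_prime by (simp add: prime_two_sided_ideal_def ideal_left_ideal)

lemmas P_carrier = left_ideal_carrier[OF P_left]
  and P_zero = left_ideal_zero[OF P_left]
  and P_add = left_ideal_add[OF P_left]
  and P_mult = left_ideal_mult[OF P_left]

lemma P_mult_right: "\<lbrakk>x \<in> P; a \<in> carrier R\<rbrakk> \<Longrightarrow> x \<otimes> a \<in> P"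
  using P_prime ideal.I_r_closed[of P R x a] by (simp add: prime_two_sided_ideal_def)

lemma P_primeD:
  assumes "a \<in> carrier R" "b \<in> carrier R" "\<And>x. x \<in> carrier R \<Longrightarrow> a \<otimes> x \<otimes> b \<in> P"
  shows "a \<in> P \<or> b \<in> P"
  using P_prime assms by (auto simp: prime_two_sided_ideal_def prime_condition_def)

text \<open>These elements act as nonzero scalars: localizing \<open>R / P\<close> at their images
  gives a finite-dimensional algebra over a field.\<close>

definition denom :: "'a set" where
  "denom = center - P"

lemma denom_carrier: "z \<in> denom \<Longrightarrow> z \<in> carrier R"
  by (simp add: denom_def center_carrier)

lemma denom_commute: "\<lbrakk>z \<in> denom; x \<in> carrier R\<rbrakk> \<Longrightarrow> z \<otimes> x = x \<otimes> z"
  by (simp add: denom_def center_commute)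

text \<open>Centrality turns \<open>z x \<in> P\<close> into \<open>z y x = y z x \<in> P\<close>
  for all \<open>y\<close>, and \<open>P\<close> is prime.\<close>

lemma denom_cancel:
  assumes z: "z \<in> denom" and x: "x \<in> carrier R" and zx: "z \<otimes> x \<in> P"
  shows "x \<in> P"
proof -
  have "z \<otimes> y \<otimes> x \<in> P" if y: "y \<in> carrier R" for y
    using P_mult[OF y zx] denom_carrier[OF z] denom_commute[OF z y] x y by (simp add: m_assoc)
  then show ?thesis using P_primeD[of z x] z x denom_carrier by (auto simp: denom_def)
qed

lemma one_denom: "\<one> \<in> denom"
  using P_proper left_ideal_carrier_iff[OF P_left] one_center by (simp add: denom_def)

lemma denom_mult: "\<lbrakk>z \<in> denom; w \<in> denom\<rbrakk> \<Longrightarrow> z \<otimes> w \<in> denom"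
  using denom_cancel[of z w] center_mult denom_carrier by (auto simp: denom_def)

text \<open>Such left ideals correspond to the left ideals of the localization of
  \<open>R / P\<close> at \<open>denom\<close>.\<close>

definition saturated :: "'a set \<Rightarrow> bool" where
  "saturated L \<longleftrightarrow> left_ideal L R \<and> P \<subseteq> L \<and>
    (\<forall>z\<in>denom. \<forall>x\<in>carrier R. z \<otimes> x \<in> L \<longrightarrow> x \<in> L)"

lemma saturatedD:
  assumes "saturated L"
  shows "left_ideal L R" "P \<subseteq> L" "\<lbrakk>z \<in> denom; x \<in> carrier R; z \<otimes> x \<in> L\<rbrakk> \<Longrightarrow> x \<in> L"
  using assms by (auto simp: saturated_def)

text \<open>For a left ideal \<open>N\<close> above \<open>P\<close>, this is the contraction of its
  extension to the localization.\<close>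

definition saturation :: "'a set \<Rightarrow> 'a set" where
  "saturation N = {x \<in> carrier R. \<exists>z\<in>denom. z \<otimes> x \<in> N}"

lemma saturation_subset:
  assumes "left_ideal N R"
  shows "N \<subseteq> saturation N"
proof
  fix x assume "x \<in> N"
  then show "x \<in> saturation N"
    using left_ideal_carrier[OF assms] one_denom by (auto simp: saturation_def intro!: bexI[of _ \<one>])
qed

lemma saturated_saturation:
  assumes N: "left_ideal N R" "P \<subseteq> N"
  shows "saturated (saturation N)"
proof -
  have "left_ideal (saturation N) R"
  proof (rule left_idealI)
    show "\<zero> \<in> saturation N" using saturation_subset[OF N(1)] left_ideal_zero[OF N(1)] by auto
  next
    fix x y assume "x \<in> saturation N" "y \<in> saturation N"
    then obtain z w where z: "z \<in> denom" "z \<otimes> x \<in> N" and w: "w \<in> denom" "w \<otimes> y \<in> N"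
      and xy: "x \<in> carrier R" "y \<in> carrier R" by (auto simp: saturation_def)
    note c = denom_carrier[OF z(1)] denom_carrier[OF w(1)]
    \<comment> \<open>The product \<open>z w\<close> serves as a common denominator for
      \<open>x\<close> and \<open>y\<close>.\<close>
    have "w \<otimes> (z \<otimes> x) \<oplus> z \<otimes> (w \<otimes> y) \<in> N"
      using left_ideal_add[OF N(1) left_ideal_mult[OF N(1) c(2) z(2)] left_ideal_mult[OF N(1) c(1) w(2)]] .
    also have "w \<otimes> (z \<otimes> x) \<oplus> z \<otimes> (w \<otimes> y) = z \<otimes> w \<otimes> (x \<oplus> y)"
      using c xy denom_commute[OF w(1) c(1)] by (simp add: r_distr m_assoc[symmetric])
    finally show "x \<oplus> y \<in> saturation N"
      using denom_mult[OF z(1) w(1)] xy by (auto simp: saturation_def)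
  next
    fix a x assume a: "a \<in> carrier R" and "x \<in> saturation N"
    then obtain z where z: "z \<in> denom" "z \<otimes> x \<in> N" and x: "x \<in> carrier R"
      by (auto simp: saturation_def)
    have "a \<otimes> (z \<otimes> x) \<in> N" using left_ideal_mult[OF N(1) a z(2)] .
    also have "a \<otimes> (z \<otimes> x) = z \<otimes> (a \<otimes> x)"
      using a x denom_carrier[OF z(1)] denom_commute[OF z(1) a] by (simp add: m_assoc[symmetric])
    finally show "a \<otimes> x \<in> saturation N" using z a x by (auto simp: saturation_def)
  qed (auto simp: saturation_def)
  moreover have "P \<subseteq> saturation N" using N saturation_subset by blast
  moreover have "x \<in> saturation N"
    if z: "z \<in> denom" and x: "x \<in> carrier R" and zx: "z \<otimes> x \<in> saturation N" for z x
  proof -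
    obtain w where w: "w \<in> denom" "w \<otimes> (z \<otimes> x) \<in> N" using zx by (auto simp: saturation_def)
    then have "w \<otimes> z \<otimes> x \<in> N" using z x denom_carrier by (simp add: m_assoc)
    then show ?thesis using denom_mult[OF w(1) z] x by (auto simp: saturation_def)
  qed
  ultimately show ?thesis by (auto simp: saturated_def)
qed

lemma saturated_carrier: "saturated (carrier R)"
  unfolding saturated_def using P_carrier by (auto intro!: left_idealI)

lemma saturated_P: "saturated P"
  unfolding saturated_def using P_left denom_cancel by auto

text \<open>The rank of \<open>L / P\<close> over the center, computed as the number of generators that occur as the
  leading term of an element of \<open>L\<close>, as in an echelon form.\<close>

primrec rank :: "'a set \<Rightarrow> 'a list \<Rightarrow> nat" where
  "rank L [] = 0"
| "rank L (h # hs) =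
    (if \<exists>z\<in>denom. \<exists>y\<in>center_span hs. z \<otimes> h \<oplus> y \<in> L then 1 else 0) + rank L hs"

lemma rank_mono:
  assumes "L \<subseteq> L'"
  shows "rank L hs \<le> rank L' hs"
proof (induction hs)
  case (Cons h hs)
  then show ?case using assms by auto
qed simp

lemma rank_le_length: "rank L hs \<le> length hs"
  by (induction hs) auto

text \<open>Every leading position of \<open>L\<close> is one of \<open>L'\<close>, and the rank
  bound forces the converse, for the first generator and for the rest separately. An element of
  \<open>L'\<close> can thus be reduced by elements of \<open>L\<close>, one generator at a time, up
  to denominators that saturation removes.\<close>

lemma span_subset_of_rank_le:
  assumes L: "saturated L" and L': "left_ideal L' R" and LL': "L \<subseteq> L'"
    and hs: "set hs \<subseteq> carrier R" and rank: "rank L' hs \<le> rank L hs"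
  shows "L' \<inter> center_span hs \<subseteq> L"
  using hs rank
proof (induction hs)
  case Nil
  then show ?case using left_ideal_zero[OF saturatedD(1)[OF L]] by auto
next
  case (Cons h hs)
  let ?lead = "\<lambda>L. \<exists>z\<in>denom. \<exists>y\<in>center_span hs. z \<otimes> h \<oplus> y \<in> L"
  have "?lead L \<Longrightarrow> ?lead L'" using LL' by blast
  moreover have "rank L hs \<le> rank L' hs" by (rule rank_mono[OF LL'])
  ultimately have lead: "?lead L' \<Longrightarrow> ?lead L" and "rank L' hs \<le> rank L hs"
    using Cons.prems(2) by (auto split: if_splits)
  with Cons have IH: "L' \<inter> center_span hs \<subseteq> L" by auto
  have h: "h \<in> carrier R" and hs: "set hs \<subseteq> carrier R" using Cons.prems by auto
  note span_c = subsetD[OF center_span_carrier[OF hs]]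
  show ?case
  proof
    fix x assume "x \<in> L' \<inter> center_span (h # hs)"
    then obtain a y where x: "x \<in> L'" "x = a \<otimes> h \<oplus> y" and a: "a \<in> center" "a \<in> carrier R"
      and y: "y \<in> center_span hs" "y \<in> carrier R" using span_c center_carrier by auto
    show "x \<in> L"
    proof (cases "a \<in> P")
      case True
      \<comment> \<open>A leading term with coefficient in \<open>P\<close> already lies in
        \<open>L\<close>, so only the tail has to be treated.\<close>
      then have "a \<otimes> h \<in> L" using P_mult_right h saturatedD(2)[OF L] by auto
      moreover from this have "y \<in> L'"
        using left_ideal_cancel_right[OF L', of y "a \<otimes> h"] x LL' a h y by (auto simp: a_comm)
      ultimately show ?thesis
        using IH y x(2) left_ideal_add[OF saturatedD(1)[OF L]] by auto
    next
      case False
      then have "?lead L'" using x a y by (auto simp: denom_def)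
      then obtain b w where b: "b \<in> denom" "b \<in> carrier R"
        and w: "w \<in> center_span hs" "w \<in> carrier R" and bw: "b \<otimes> h \<oplus> w \<in> L"
        using lead span_c denom_carrier by metis
      have bc: "b \<in> center" using b by (simp add: denom_def)
      \<comment> \<open>Crosswise multiplication by the two leading coefficients cancels the
        \<open>h\<close>-term and leaves an element of the shorter span. Then
        \<open>b x \<in> L\<close> follows, and \<open>b\<close> is divided out.\<close>
      have "b \<otimes> x \<ominus> a \<otimes> (b \<otimes> h \<oplus> w) = (b \<otimes> a \<ominus> a \<otimes> b) \<otimes> h \<oplus> (b \<otimes> y \<ominus> a \<otimes> w)"
        unfolding x(2) using bc a b w h y by (intro minus_mult_cross)
      also have "\<dots> = b \<otimes> y \<ominus> a \<otimes> w"
        using a b h y w center_commute[OF bc a(2)] by (simp add: minus_eq r_neg)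
      finally have eq: "b \<otimes> x \<ominus> a \<otimes> (b \<otimes> h \<oplus> w) = b \<otimes> y \<ominus> a \<otimes> w" .
      have "b \<otimes> x \<ominus> a \<otimes> (b \<otimes> h \<oplus> w) \<in> L'"
        using x bw LL' a b by (intro left_ideal_minus[OF L'] left_ideal_mult[OF L']) auto
      moreover have "b \<otimes> y \<ominus> a \<otimes> w \<in> center_span hs"
        using hs bc a y w by (intro center_span_cross)
      ultimately have "b \<otimes> x \<ominus> a \<otimes> (b \<otimes> h \<oplus> w) \<in> L" using IH eq by auto
      moreover have "a \<otimes> (b \<otimes> h \<oplus> w) \<in> L"
        using left_ideal_mult[OF saturatedD(1)[OF L] a(2) bw] .
      ultimately have "(b \<otimes> x \<ominus> a \<otimes> (b \<otimes> h \<oplus> w)) \<oplus> a \<otimes> (b \<otimes> h \<oplus> w) \<in> L"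
        by (rule left_ideal_add[OF saturatedD(1)[OF L]])
      moreover have xc: "x \<in> carrier R" using left_ideal_carrier[OF L' x(1)] .
      ultimately have "b \<otimes> x \<in> L"
        using a b h w by (simp add: minus_eq a_assoc l_neg)
      then show ?thesis using saturatedD(3)[OF L b(1) xc] by simp
    qed
  qed
qed

text \<open>Since \<open>gs\<close> spans the ring, the rank detects proper inclusions of saturated
  left ideals, as dimension does for subspaces.\<close>

lemma saturated_eqI:
  assumes "saturated L" "saturated L'" "L \<subseteq> L'" "rank L' gs \<le> rank L gs"
  shows "L = L'"
  using span_subset_of_rank_le[OF assms(1) saturatedD(1)[OF assms(2)] assms(3) generators(1) assms(4)]
    left_ideal_carrier[OF saturatedD(1)[OF assms(2)]] generators(2) assms(3) by blast

text \<open>A candidate of least rank is minimal: by \<open>saturated_eqI\<close>, a candidate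
  inside it of no smaller rank equals it.\<close>

lemma saturated_minimal:
  assumes "saturated L0" "Q L0"
  obtains L where "saturated L" "Q L" "\<forall>L'. saturated L' \<and> Q L' \<and> L' \<subseteq> L \<longrightarrow> L' = L"
proof -
  obtain L where L: "saturated L \<and> Q L"
    and min: "\<And>L'. saturated L' \<and> Q L' \<Longrightarrow> rank L gs \<le> rank L' gs"
    using ex_has_least_nat[of "\<lambda>L. saturated L \<and> Q L" L0 "\<lambda>L. rank L gs"] assms by blast
  show thesis using L min saturated_eqI by (intro that[of L]) blast+
qed

text \<open>The rank never exceeds the number of generators, so a candidate of greatest rank exists,
  and \<open>saturated_eqI\<close> makes it maximal.\<close>

lemma saturated_maximal:
  assumes "saturated L0" "Q L0"
  obtains L where "saturated L" "Q L" "\<forall>L'. saturated L' \<and> Q L' \<and> L \<subseteq> L' \<longrightarrow> L' = L"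
proof -
  have "\<forall>L. saturated L \<and> Q L \<longrightarrow> rank L gs < Suc (length gs)"
    using rank_le_length by (simp add: less_Suc_eq_le)
  then obtain L where L: "saturated L \<and> Q L"
    and max: "\<And>L'. saturated L' \<and> Q L' \<Longrightarrow> rank L' gs \<le> rank L gs"
    using ex_has_greatest_nat[of "\<lambda>L. saturated L \<and> Q L" L0 "\<lambda>L. rank L gs"] assms by blast
  show thesis using L max saturated_eqI by (intro that[of L]) blast+
qed

end

section \<open>Two-sided ideals meet the center\<close>

context prime_over_center
begin

definition left_annih :: "'a set \<Rightarrow> 'a set" where
  "left_annih F = {x \<in> carrier R. \<forall>u\<in>F. x \<otimes> u \<in> P}"

lemma saturated_left_annih:
  assumes F: "F \<subseteq> carrier R"
  shows "saturated (left_annih F)"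
proof -
  have Fc: "u \<in> F \<Longrightarrow> u \<in> carrier R" for u using F by auto
  have "left_ideal (left_annih F) R"
    by (rule left_idealI) (auto simp: left_annih_def Fc l_distr m_assoc P_zero P_add P_mult)
  moreover have "P \<subseteq> left_annih F"
    using P_carrier P_mult_right Fc by (auto simp: left_annih_def)
  moreover have "x \<in> left_annih F"
    if z: "z \<in> denom" and x: "x \<in> carrier R" and zx: "z \<otimes> x \<in> left_annih F" for z x
  proof -
    have "x \<otimes> u \<in> P" if u: "u \<in> F" for u
    proof (rule denom_cancel[OF z])
      show "z \<otimes> (x \<otimes> u) \<in> P"
        using zx u x Fc denom_carrier[OF z] by (simp add: left_annih_def m_assoc)
    qed (use x u Fc in simp)
    then show ?thesis using x by (simp add: left_annih_def)
  qed
  ultimately show ?thesis by (auto simp: saturated_def)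
qed

text \<open>In the localization of \<open>R / P\<close> these become the minimal left
  ideals.\<close>

definition minimal_saturated :: "'a set \<Rightarrow> bool" where
  "minimal_saturated U \<longleftrightarrow> saturated U \<and> U \<noteq> P \<and>
    (\<forall>L. saturated L \<and> L \<noteq> P \<and> L \<subseteq> U \<longrightarrow> L = U)"

lemma minimal_saturated_exists: "\<exists>U. minimal_saturated U"
  using saturated_minimal[of "carrier R" "\<lambda>L. L \<noteq> P"] saturated_carrier P_proper
  unfolding minimal_saturated_def by metis

text \<open>\<open>U / P\<close> is simple up to denominators and \<open>(T \<inter> L) u\<close> is nonzero in it, so it reaches \<open>v\<close>.\<close>

lemma minimal_saturated_reach:
  assumes U: "minimal_saturated U" and L: "left_ideal L R"
    and T: "left_ideal T R" "\<And>t a. \<lbrakk>t \<in> T; a \<in> carrier R\<rbrakk> \<Longrightarrow> t \<otimes> a \<in> T" "\<not> T \<subseteq> P"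
    and u: "u \<in> U" and v: "v \<in> U" and l: "l \<in> L" "l \<otimes> u \<notin> P"
  obtains e z where "e \<in> T \<inter> L" "z \<in> denom" "z \<otimes> v \<ominus> e \<otimes> u \<in> P"
proof -
  have U': "saturated U" "left_ideal U R" "P \<subseteq> U"
    using U saturatedD[of U] by (auto simp: minimal_saturated_def)
  have c: "u \<in> carrier R" "v \<in> carrier R" "l \<in> carrier R"
    using u v l left_ideal_carrier[OF U'(2)] left_ideal_carrier[OF L] by auto
  have TL: "left_ideal (T \<inter> L) R" by (rule left_ideal_Int[OF T(1) L])
  define M where "M = (\<lambda>x. x \<otimes> u) ` (T \<inter> L)"
  have M: "left_ideal M R" unfolding M_def by (rule left_ideal_mult_right[OF TL c(1)])
  define N where "N = P <+>\<^bsub>R\<^esub> M"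
  have N: "left_ideal N R" "P \<subseteq> N" "M \<subseteq> N"
    unfolding N_def using left_ideal_sum[OF P_left M] subset_sum[OF P_left M] by auto
  have "M \<subseteq> U"
    unfolding M_def using u left_ideal_mult[OF U'(2)] left_ideal_carrier[OF TL] by auto
  then have "N \<subseteq> U"
    unfolding N_def set_add_def' using U'(3) left_ideal_add[OF U'(2)] by blast
  then have "saturation N \<subseteq> U"
    using saturatedD(3)[OF U'(1)] by (auto simp: saturation_def)
  moreover have "saturation N \<noteq> P"
  proof -
    obtain t where t: "t \<in> T" "t \<notin> P" "t \<in> carrier R"
      using T(3) left_ideal_carrier[OF T(1)] by auto
    \<comment> \<open>Primeness supplies \<open>a\<close> with \<open>t a l u\<close> outside
      \<open>P\<close>. The factor \<open>t a l\<close> lies in \<open>T\<close> because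
      \<open>T\<close> is two-sided, and in \<open>L\<close> because \<open>L\<close> is a left
      ideal.\<close>
    then obtain a where a: "a \<in> carrier R" "t \<otimes> a \<otimes> (l \<otimes> u) \<notin> P"
      using P_primeD[of t "l \<otimes> u"] l c by auto
    have "t \<otimes> a \<otimes> l \<in> T" using T(2) t a c by auto
    moreover have "t \<otimes> a \<otimes> l \<in> L" using left_ideal_mult[OF L _ l(1)] t a by auto
    ultimately have "t \<otimes> a \<otimes> l \<otimes> u \<in> M" by (auto simp: M_def)
    then have "t \<otimes> a \<otimes> (l \<otimes> u) \<in> saturation N"
      using t a c N(3) saturation_subset[OF N(1)] by (auto simp: m_assoc)
    then show ?thesis using a by auto
  qed
  ultimately have "saturation N = U"
    using U saturated_saturation[OF N(1,2)] by (auto simp: minimal_saturated_def)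
  then obtain z where z: "z \<in> denom" "z \<otimes> v \<in> N" using v by (auto simp: saturation_def)
  then obtain p e where p: "p \<in> P" and e: "e \<in> T \<inter> L" and eq: "z \<otimes> v = p \<oplus> e \<otimes> u"
    by (auto simp: N_def M_def set_add_def')
  have "z \<otimes> v \<ominus> e \<otimes> u = p"
    unfolding eq using P_carrier[OF p] left_ideal_carrier[OF TL e] c
    by (simp add: minus_eq a_assoc r_neg)
  then show thesis using that[OF e z(1)] p by simp
qed

text \<open>An induction in the style of the Jacobson density theorem. Suppose \<open>e\<close> acts
  on \<open>F\<close> as the scalar \<open>z\<close> modulo \<open>P\<close>, but not on
  \<open>u\<close>. Then \<open>minimal_saturated_reach\<close>, applied to
  \<open>left_annih F\<close> and \<open>e - z\<close>, gives \<open>f \<in> T\<close> that kills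
  \<open>F\<close> and acts on \<open>u\<close> as \<open>w (e - z)\<close>. Hence
  \<open>w e - f\<close> acts as \<open>w z\<close> on \<open>F\<close> and on
  \<open>u\<close>.\<close>

lemma central_action_on_finite:
  assumes U: "minimal_saturated U"
    and T: "left_ideal T R" "\<And>t a. \<lbrakk>t \<in> T; a \<in> carrier R\<rbrakk> \<Longrightarrow> t \<otimes> a \<in> T" "\<not> T \<subseteq> P"
    and F: "finite F" "F \<subseteq> U"
  shows "\<exists>e\<in>T. \<exists>z\<in>denom. e \<ominus> z \<in> left_annih F"
  using F
proof (induction F rule: finite_induct)
  case empty
  have "\<zero> \<ominus> \<one> \<in> left_annih {}" by (simp add: left_annih_def)
  then show ?case using left_ideal_zero[OF T(1)] one_denom by blast
next
  case (insert u F)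
  then obtain e z where ez: "e \<in> T" "z \<in> denom" "e \<ominus> z \<in> left_annih F" by auto
  have U': "left_ideal U R" using U saturatedD(1) by (auto simp: minimal_saturated_def)
  have Fc: "F \<subseteq> carrier R" "u \<in> carrier R" "u \<in> U"
    using insert.prems left_ideal_carrier[OF U'] by auto
  have L: "left_ideal (left_annih F) R"
    using saturated_left_annih[OF Fc(1)] by (rule saturatedD(1))
  have c: "e \<in> carrier R" "z \<in> carrier R"
    using ez left_ideal_carrier[OF T(1)] denom_carrier by auto
  show ?case
  proof (cases "(e \<ominus> z) \<otimes> u \<in> P")
    case True
    then have "e \<ominus> z \<in> left_annih (insert u F)" using ez by (simp add: left_annih_def)
    then show ?thesis using ez by blast
  next
    case False
    have "(e \<ominus> z) \<otimes> u \<in> U" using left_ideal_mult[OF U' _ Fc(3)] c by simp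
    then obtain f w where f: "f \<in> T \<inter> left_annih F" and w: "w \<in> denom"
      and fw: "w \<otimes> ((e \<ominus> z) \<otimes> u) \<ominus> f \<otimes> u \<in> P"
      using minimal_saturated_reach[OF U L T Fc(3) _ ez(3) False] by metis
    have c': "w \<in> carrier R" "f \<in> carrier R"
      using denom_carrier[OF w] f left_ideal_carrier[OF L] by auto
    have eq: "(w \<otimes> e \<ominus> f) \<ominus> w \<otimes> z = w \<otimes> (e \<ominus> z) \<ominus> f"
      using c c' by (simp add: minus_eq r_distr r_minus a_ac)
    have "w \<otimes> (e \<ominus> z) \<ominus> f \<in> left_annih F"
      using f left_ideal_minus[OF L left_ideal_mult[OF L c'(1) ez(3)]] by simp
    moreover have "(w \<otimes> (e \<ominus> z) \<ominus> f) \<otimes> u \<in> P"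
      using fw c c' Fc by (simp add: minus_eq l_distr l_minus m_assoc)
    ultimately have "(w \<otimes> e \<ominus> f) \<ominus> w \<otimes> z \<in> left_annih (insert u F)"
      unfolding eq by (simp add: left_annih_def)
    moreover have "w \<otimes> e \<ominus> f \<in> T"
      using f ez c' by (intro left_ideal_minus[OF T(1)] left_ideal_mult[OF T(1)]) auto
    ultimately show ?thesis using denom_mult[OF w ez(2)] by blast
  qed
qed

text \<open>Among the annihilators of finite subsets of \<open>U\<close> a minimal one is chosen.
  Adding a further \<open>u \<in> U\<close> cannot shrink it, so it kills all of \<open>U\<close>
  modulo \<open>P\<close>; as \<open>U\<close> is a left ideal not inside \<open>P\<close>,
  primeness forces it into \<open>P\<close>.\<close>

lemma finite_faithful_subset:
  assumes U: "left_ideal U R" "\<not> U \<subseteq> P"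
  obtains F where "finite F" "F \<subseteq> U" "left_annih F \<subseteq> P"
proof -
  note Uc = left_ideal_carrier[OF U(1)]
  define Q where "Q L \<longleftrightarrow> (\<exists>F. finite F \<and> F \<subseteq> U \<and> L = left_annih F)" for L
  have "saturated (left_annih {})" "Q (left_annih {})"
    using saturated_left_annih[of "{}"] by (auto simp: Q_def)
  then obtain L where L: "saturated L" "Q L"
    and min: "\<forall>L'. saturated L' \<and> Q L' \<and> L' \<subseteq> L \<longrightarrow> L' = L"
    by (rule saturated_minimal)
  obtain F where F: "finite F" "F \<subseteq> U" "L = left_annih F" using L(2) unfolding Q_def by blast
  have ann: "x \<otimes> u \<in> P" if x: "x \<in> L" and u: "u \<in> U" for x u
  proof -
    have "left_annih (insert u F) \<subseteq> L" unfolding F(3) by (auto simp: left_annih_def)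
    moreover have "saturated (left_annih (insert u F))"
      using F u Uc by (intro saturated_left_annih) auto
    moreover have "Q (left_annih (insert u F))"
      unfolding Q_def using F u by (intro exI[of _ "insert u F"]) simp
    ultimately have "left_annih (insert u F) = L" using min by blast
    then show ?thesis using x by (auto simp: left_annih_def)
  qed
  obtain u where u: "u \<in> U" "u \<notin> P" using U(2) by auto
  have "x \<in> P" if x: "x \<in> L" for x
  proof -
    have xc: "x \<in> carrier R" using x by (simp add: F(3) left_annih_def)
    have "x \<otimes> y \<otimes> u \<in> P" if "y \<in> carrier R" for y
      using ann[OF x left_ideal_mult[OF U(1) that u(1)]] xc that Uc[OF u(1)] by (simp add: m_assoc)
    then show ?thesis using P_primeD[OF xc Uc[OF u(1)]] u by blast
  qed
  then show thesis using that[of F] F by blast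
qed

text \<open>This expresses that the localization of \<open>R / P\<close> is a simple ring. Some
  \<open>e \<in> T\<close> acts as a denominator \<open>z\<close> on a finite set with annihilator
  inside \<open>P\<close>, so \<open>e - z \<in> P \<subseteq> T\<close> and therefore
  \<open>z \<in> T\<close>.\<close>

lemma ideal_meets_denom:
  assumes T: "ideal T R" "P \<subseteq> T" "T \<noteq> P"
  shows "T \<inter> denom \<noteq> {}"
proof -
  have Tl: "left_ideal T R" by (rule ideal_left_ideal[OF T(1)])
  obtain U where U: "minimal_saturated U" using minimal_saturated_exists by blast
  then have "left_ideal U R" "\<not> U \<subseteq> P"
    using saturatedD[of U] by (auto simp: minimal_saturated_def)
  then obtain F where F: "finite F" "F \<subseteq> U" "left_annih F \<subseteq> P"
    by (rule finite_faithful_subset)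
  obtain e z where ez: "e \<in> T" "z \<in> denom" "e \<ominus> z \<in> left_annih F"
    using central_action_on_finite[OF U Tl ideal.I_r_closed[OF T(1)] _ F(1,2)] T by blast
  have "e \<ominus> (e \<ominus> z) \<in> T" using ez F T left_ideal_minus[OF Tl] by blast
  also have "e \<ominus> (e \<ominus> z) = z"
    using left_ideal_carrier[OF Tl ez(1)] denom_carrier[OF ez(2)]
    by (simp add: minus_eq minus_add a_assoc[symmetric] r_neg)
  finally show ?thesis using ez by blast
qed

section \<open>Complements\<close>

text \<open>Essentiality gives one \<open>x\<close> outside \<open>P\<close> that multiplies all
  generators into \<open>E\<close>. Since the generators span the ring over the center,
  \<open>x R \<subseteq> E\<close>.\<close>

lemma core_essential:
  assumes E: "left_ideal E R" "P \<subseteq> E"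
    and essential: "\<And>L. \<lbrakk>left_ideal L R; \<not> L \<subseteq> P\<rbrakk> \<Longrightarrow> \<not> L \<inter> E \<subseteq> P"
  shows "\<not> core R E \<subseteq> P"
proof -
  have "\<exists>x\<in>carrier R. x \<notin> P \<and> (\<forall>g\<in>set hs. x \<otimes> g \<in> E)" if "set hs \<subseteq> carrier R" for hs
    using that
  proof (induction hs)
    case Nil
    then show ?case using one_denom by (auto simp: denom_def intro!: bexI[of _ \<one>])
  next
    case (Cons h hs)
    then obtain x where x: "x \<in> carrier R" "x \<notin> P" "\<And>g. g \<in> set hs \<Longrightarrow> x \<otimes> g \<in> E" by auto
    have h: "h \<in> carrier R" using Cons.prems by simp
    show ?case
    proof (cases "x \<otimes> h \<in> P")
      case True
      then show ?thesis using x E(2) by auto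
    next
      case False
      \<comment> \<open>The left ideal generated by \<open>x h\<close> is not inside
        \<open>P\<close>, so it meets \<open>E\<close> in some \<open>a x h\<close> outside
        \<open>P\<close>. Replacing \<open>x\<close> by \<open>a x\<close> keeps the earlier
        products in \<open>E\<close> and stays outside \<open>P\<close>.\<close>
      let ?L = "(\<lambda>a. a \<otimes> (x \<otimes> h)) ` carrier R"
      have "left_ideal ?L R"
        using x h saturatedD(1)[OF saturated_carrier] by (intro left_ideal_mult_right) auto
      moreover have "x \<otimes> h \<in> ?L" using x h by (intro rev_image_eqI[of \<one>]) auto
      ultimately obtain y where y: "y \<in> ?L" "y \<in> E" "y \<notin> P" using essential False by blast
      then obtain a where a: "a \<in> carrier R" "a \<otimes> x \<otimes> h \<in> E" "a \<otimes> x \<otimes> h \<notin> P"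
        using x h by (auto simp: m_assoc)
      then have "a \<otimes> x \<notin> P" using P_mult_right h by blast
      moreover have "a \<otimes> x \<otimes> g \<in> E" if "g \<in> set hs" for g
        using left_ideal_mult[OF E(1) a(1) x(3)[OF that]] that a x Cons.prems
        by (auto simp: m_assoc subset_iff)
      ultimately show ?thesis using a x by (intro bexI[of _ "a \<otimes> x"]) auto
    qed
  qed
  then obtain x where x: "x \<in> carrier R" "x \<notin> P" and xE: "\<And>g. g \<in> set gs \<Longrightarrow> x \<otimes> g \<in> E"
    using generators(1) by blast
  have "x \<otimes> y \<in> E" if "set hs \<subseteq> set gs" "y \<in> center_span hs" for hs y
    using that
  proof (induction hs arbitrary: y)
    case Nil
    then show ?case using x left_ideal_zero[OF E(1)] by simp
  next
    case (Cons h hs)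
    then obtain z w where y: "y = z \<otimes> h \<oplus> w" and z: "z \<in> center" and w: "w \<in> center_span hs"
      by auto
    have c: "h \<in> carrier R" "w \<in> carrier R" "z \<in> carrier R"
      using Cons.prems generators(1) center_span_carrier[of hs] w center_carrier[OF z] by auto
    have "x \<otimes> y = z \<otimes> (x \<otimes> h) \<oplus> x \<otimes> w"
      unfolding y using c x center_commute[OF z x(1)] by (simp add: r_distr m_assoc[symmetric])
    moreover have "z \<otimes> (x \<otimes> h) \<in> E"
      using left_ideal_mult[OF E(1) c(3)] xE Cons.prems by auto
    moreover have "x \<otimes> w \<in> E" using Cons w by auto
    ultimately show ?case using left_ideal_add[OF E(1)] by simp
  qed
  then have "x \<in> core R E" using x generators(2) by (auto simp: core_def)
  then show ?thesis using x by blast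
qed

text \<open>Let \<open>V\<close> be maximal among the saturated left ideals that meet
  \<open>I\<close> in \<open>P\<close>. Then \<open>I + V\<close> is essential modulo
  \<open>P\<close>, so its core is strictly larger than \<open>P\<close> and contains a denominator
  \<open>z = i + v\<close>.\<close>

lemma saturated_complement:
  assumes I: "saturated I"
  obtains i v z where "z \<in> denom" "i \<in> I" "v \<in> carrier R" "z = i \<oplus> v"
    "\<forall>x\<in>I. x \<otimes> v \<in> P"
proof -
  note I' = saturatedD[OF I]
  have "P \<inter> I = P" using I'(2) by blast
  with saturated_P obtain V where V: "saturated V" "V \<inter> I = P"
    and max: "\<forall>V'. saturated V' \<and> V' \<inter> I = P \<and> V \<subseteq> V' \<longrightarrow> V' = V"
    by (rule saturated_maximal)
  note V' = saturatedD[OF V(1)]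
  define E where "E = I <+>\<^bsub>R\<^esub> V"
  have E: "left_ideal E R" "I \<subseteq> E" "V \<subseteq> E"
    unfolding E_def using left_ideal_sum[OF I'(1) V'(1)] subset_sum[OF I'(1) V'(1)] by auto
  have "\<not> L \<inter> E \<subseteq> P" if L: "left_ideal L R" "\<not> L \<subseteq> P" for L
  proof
    \<comment> \<open>If \<open>L\<close> meets \<open>I + V\<close> only inside \<open>P\<close>,
      then the saturation of \<open>V + L\<close> still meets \<open>I\<close> in \<open>P\<close>.
      Maximality of \<open>V\<close> gives \<open>L \<subseteq> V\<close>, so \<open>L\<close> would
      lie in \<open>P\<close>.\<close>
    assume LE: "L \<inter> E \<subseteq> P"
    define N where "N = V <+>\<^bsub>R\<^esub> L"
    have N: "left_ideal N R" "V \<subseteq> N" "L \<subseteq> N"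
      unfolding N_def using left_ideal_sum[OF V'(1) L(1)] subset_sum[OF V'(1) L(1)] by auto
    have "x \<in> P" if x: "x \<in> saturation N" "x \<in> I" for x
    proof -
      obtain z where z: "z \<in> denom" "z \<otimes> x \<in> N" "x \<in> carrier R"
        using x by (auto simp: saturation_def)
      then obtain v l where v: "v \<in> V" and l: "l \<in> L" and eq: "z \<otimes> x = v \<oplus> l"
        by (auto simp: N_def set_add_def')
      have c: "v \<in> carrier R" "l \<in> carrier R"
        using left_ideal_carrier[OF V'(1) v] left_ideal_carrier[OF L(1) l] .
      have zx: "z \<otimes> x \<in> I" using left_ideal_mult[OF I'(1) denom_carrier[OF z(1)] x(2)] .
      then have "l \<in> E"
        using left_ideal_cancel_right[OF E(1), of l v] c v eq E(2,3) by (auto simp: a_comm)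
      then have "l \<in> P" using l LE by blast
      moreover from this have "v \<in> I"
        using left_ideal_cancel_right[OF I'(1), of v l] c zx eq I'(2) by auto
      then have "v \<in> P" using v V(2) by blast
      ultimately have "z \<otimes> x \<in> P" unfolding eq by (simp add: P_add)
      then show ?thesis using denom_cancel z by blast
    qed
    moreover have NP: "P \<subseteq> N" using N(2) V'(2) by blast
    ultimately have "saturation N \<inter> I = P"
      using saturation_subset[OF N(1)] I'(2) by blast
    then have "saturation N = V"
      using max saturated_saturation[OF N(1) NP] saturation_subset[OF N(1)] N(2) by blast
    then have "L \<subseteq> E" using saturation_subset[OF N(1)] N(3) E(3) by blast
    then show False using LE L(2) by blast
  qed
  moreover have PE: "P \<subseteq> E" using I'(2) E(2) by blast
  ultimately have "core R E \<noteq> P" using core_essential[OF E(1)] by blast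
  moreover have "P \<subseteq> core R E"
    using PE P_carrier P_mult_right unfolding core_def by blast
  ultimately obtain z where z: "z \<in> denom" "z \<in> E"
    using ideal_meets_denom[OF core_ideal[OF E(1)]] core_subset by blast
  then obtain i v where iv: "i \<in> I" "v \<in> V" "z = i \<oplus> v" by (auto simp: E_def set_add_def')
  have c: "i \<in> carrier R" "v \<in> carrier R"
    using left_ideal_carrier[OF I'(1) iv(1)] left_ideal_carrier[OF V'(1) iv(2)] .
  \<comment> \<open>Centrality of \<open>z\<close> gives \<open>x v = z x - x i \<in> I\<close>,
    while \<open>x v \<in> V\<close>; the two meet in \<open>P\<close>.\<close>
  have "x \<otimes> v \<in> P" if x: "x \<in> I" for x
  proof -
    have xc: "x \<in> carrier R" using left_ideal_carrier[OF I'(1) x] .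
    have "x \<otimes> v \<oplus> x \<otimes> i = z \<otimes> x"
      using denom_commute[OF z(1) xc] xc c iv(3) by (simp add: r_distr a_comm)
    then have "x \<otimes> v \<oplus> x \<otimes> i \<in> I"
      using left_ideal_mult[OF I'(1) denom_carrier[OF z(1)] x] by simp
    then have "x \<otimes> v \<in> I"
      using left_ideal_cancel_right[OF I'(1) _ _ _ left_ideal_mult[OF I'(1) xc iv(1)], of "x \<otimes> v"]
        xc c by simp
    then show ?thesis using left_ideal_mult[OF V'(1) xc iv(2)] V(2) by blast
  qed
  then show thesis using that z iv c by blast
qed

text \<open>With \<open>z = i + v\<close> from the complement, \<open>b v \<in> P\<close> would give
  \<open>z b = b i + b v \<in> I\<close>, and saturation would put \<open>b\<close> in
  \<open>I\<close>.\<close>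

lemma saturated_separation:
  assumes I: "saturated I" and b: "b \<in> carrier R" "b \<notin> I"
  obtains v where "v \<in> carrier R" "b \<otimes> v \<notin> P" "\<forall>x\<in>I. x \<otimes> v \<in> P"
proof -
  note I' = saturatedD[OF I]
  obtain i v z where z: "z \<in> denom" and i: "i \<in> I" and v: "v \<in> carrier R" and eq: "z = i \<oplus> v"
    and ann: "\<forall>x\<in>I. x \<otimes> v \<in> P"
    by (rule saturated_complement[OF I])
  have "b \<otimes> v \<notin> P"
  proof
    assume bv: "b \<otimes> v \<in> P"
    have "z \<otimes> b = b \<otimes> i \<oplus> b \<otimes> v"
      using denom_commute[OF z b(1)] b v left_ideal_carrier[OF I'(1) i] eq by (simp add: r_distr)
    then have "z \<otimes> b \<in> I"
      using left_ideal_add[OF I'(1) left_ideal_mult[OF I'(1) b(1) i]] bv I'(2) by auto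
    then show False using I'(3)[OF z b(1)] b by blast
  qed
  then show thesis using that v ann by blast
qed

end

section \<open>From Jacobson to weakly left Jacobson\<close>

lemma (in ring) prime_left_ideal_separation:
  assumes fg: "finitely_generated_module (ring_center R) (ring_as_module R)"
    and I: "prime_left_ideal I R" and b: "b \<in> carrier R" "b \<notin> I"
  obtains v where "v \<in> carrier R" "b \<otimes> v \<notin> core R I" "\<forall>x\<in>I. x \<otimes> v \<in> core R I"
proof -
  obtain gs where gs: "set gs \<subseteq> carrier R" "carrier R \<subseteq> center_span gs"
    using finitely_generated_center_span[OF fg] .
  have "core R I \<noteq> carrier R" using b core_subset by blast
  then interpret prime_over_center R "core R I" gs
    using core_prime[OF I] gs by unfold_locales
  have left: "left_ideal I R" using I by (simp add: prime_left_ideal_def)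
  \<comment> \<open>A prime left ideal is saturated over its own core: \<open>z x \<in> I\<close>
    with \<open>z\<close> central gives \<open>z y x \<in> I\<close> for all \<open>y\<close>. A
    central \<open>z \<in> I\<close> would lie in the core, which \<open>denom\<close>
    excludes.\<close>
  have "x \<in> I" if z: "z \<in> denom" and x: "x \<in> carrier R" and zx: "z \<otimes> x \<in> I" for z x
  proof -
    have zc: "z \<in> carrier R" using denom_carrier[OF z] .
    have "z \<otimes> y \<otimes> x \<in> I" if y: "y \<in> carrier R" for y
      using left_ideal_mult[OF left y zx] denom_commute[OF z y] zc x y by (simp add: m_assoc)
    then have "z \<in> I \<or> x \<in> I"
      using I zc x by (simp add: prime_left_ideal_def prime_condition_def)
    moreover have "z \<notin> I"
    proof
      assume zI: "z \<in> I"
      have "z \<otimes> y \<in> I" if "y \<in> carrier R" for y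
        using left_ideal_mult[OF left that zI] denom_commute[OF z that] by simp
      then have "z \<in> core R I" using zc by (simp add: core_def)
      then show False using z by (simp add: denom_def)
    qed
    ultimately show ?thesis by blast
  qed
  then have "saturated I" using left core_subset by (auto simp: saturated_def)
  then show thesis using saturated_separation[OF _ b] that by blast
qed

text \<open>It suffices that each \<open>b\<close> outside \<open>I\<close> is missed by some
  maximal left ideal above \<open>I\<close>, for then \<open>I\<close> is the intersection of all
  maximal left ideals above it.\<close>

lemma (in ring) jacobson_imp_weakly_left_jacobson:
  assumes fg: "finitely_generated_module (ring_center R) (ring_as_module R)"
    and jac: "jacobson R"
  shows "weakly_left_jacobson R"
  unfolding weakly_left_jacobson_def
proof (intro allI impI)
  fix I assume I: "prime_left_ideal I R"
  have Ic: "I \<subseteq> carrier R"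
    using I left_ideal_carrier by (auto simp: prime_left_ideal_def)
  have "intersection_of R (\<lambda>J. left_primitive_ideal J R) (core R I)"
    using jac core_prime[OF I] by (simp add: jacobson_def)
  then obtain F where F: "\<forall>Q\<in>F. left_primitive_ideal Q R" "core R I = carrier R \<inter> \<Inter>F"
    unfolding intersection_of_def by (elim exE conjE)
  have sep: "\<exists>J. maximal_left_ideal J R \<and> I \<subseteq> J \<and> b \<notin> J" if b: "b \<in> carrier R" "b \<notin> I" for b
  proof -
    obtain v where v: "v \<in> carrier R" "b \<otimes> v \<notin> core R I" "\<forall>x\<in>I. x \<otimes> v \<in> core R I"
      using prime_left_ideal_separation[OF fg I b] .
    \<comment> \<open>As \<open>b v\<close> is outside \<open>core R I\<close>, some primitive
      member of the family misses it; its simple module provides \<open>m\<close> with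
      \<open>b v m\<close> nonzero.\<close>
    then obtain Q where Q: "Q \<in> F" "b \<otimes> v \<notin> Q" using F(2) b by auto
    then obtain M :: "('a, 'a set) module" where M: "simple_left_module R M" "Q = annihilator R M"
      using F(1) unfolding left_primitive_ideal_def by blast
    interpret M: left_module R M using M(1) by (simp add: simple_left_module_def)
    obtain m where m: "m \<in> carrier M" "(b \<otimes> v) \<odot>\<^bsub>M\<^esub> m \<noteq> \<zero>\<^bsub>M\<^esub>"
      using Q(2) b v M(2) by (auto simp: annihilator_def)
    let ?n = "v \<odot>\<^bsub>M\<^esub> m"
    let ?J = "{x \<in> carrier R. x \<odot>\<^bsub>M\<^esub> ?n = \<zero>\<^bsub>M\<^esub>}"
    have n: "?n \<in> carrier M" and bn: "b \<odot>\<^bsub>M\<^esub> ?n \<noteq> \<zero>\<^bsub>M\<^esub>"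
      using m v b by (simp_all add: M.smult_assoc1[symmetric])
    have "b \<odot>\<^bsub>M\<^esub> \<zero>\<^bsub>M\<^esub> = \<zero>\<^bsub>M\<^esub>"
      using M.smult_r_distr[OF b(1) M.M.zero_closed M.M.zero_closed] b
      by (metis M.M.add.r_cancel_one M.M.l_zero M.M.zero_closed M.smult_closed)
    with bn have "?n \<noteq> \<zero>\<^bsub>M\<^esub>" by metis
    then have "maximal_left_ideal ?J R"
      using maximal_left_ideal_point_annihilator[OF M(1) n] by blast
    \<comment> \<open>For \<open>x \<in> I\<close> the product \<open>x v\<close> lies in
      \<open>core R I\<close>, hence in \<open>Q\<close>, so \<open>x\<close> kills
      \<open>v m\<close>.\<close>
    moreover have "x \<in> ?J" if x: "x \<in> I" for x
    proof -
      have "x \<otimes> v \<in> Q" using v(3) x F(2) Q(1) by blast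
      then show ?thesis
        using x Ic v(1) m(1) M(2) by (auto simp: annihilator_def M.smult_assoc1[symmetric])
    qed
    ultimately show ?thesis using bn by blast
  qed
  have "I = carrier R \<inter> \<Inter>{J. maximal_left_ideal J R \<and> I \<subseteq> J}"
    using sep Ic by blast
  then show "intersection_of R (\<lambda>J. maximal_left_ideal J R) I"
    unfolding intersection_of_def
    by (intro exI[of _ "{J. maximal_left_ideal J R \<and> I \<subseteq> J}"]) simp
qed

theorem corollary17:
  fixes A :: "('a, 'm) ring_scheme"
  assumes "ring A"
    and "finitely_generated_module (ring_center A) (ring_as_module A)"
  shows "weakly_left_jacobson A \<longleftrightarrow> jacobson A"
  using ring.weakly_left_jacobson_imp_jacobson[OF assms(1)]
    ring.jacobson_imp_weakly_left_jacobson[OF assms] by blast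

end
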